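(* There is an algorithm which, given positive integers $c,d$, a totally unimodular $c\times d$ matrix $A$, an integer vector $b\in\mathbb{Z}^c$, and a vector $a\in\mathbb{Z}^d$, solves the monoid decomposition problem for $S=\{x\in\mathbb{Z}^d : Ax\le b\}$ and $a$ (that is, decides whether $a\in\mathrm{mon}(S)$ and, if yes, finds a decomposition $a=\sum_k\lambda_k x^k$ with all $\lambda_k\in\mathbb{Z}_+$ and all $x^k\in S$) in time polynomial in the binary-encoding length of $A$, $b$, and $a$, even when the dimension $d$ is variable (part of the input).
   Context: $\mathbb{Z}_+$ denotes the nonnegative integers. For a set $S\subseteq\mathbb{Z}^d$, the monoid generated by $S$ is $$\mathrm{mon}(S)=\left\{\sum_{k=1}^m\lambda_k x^k : m,\lambda_1,\dots,\lambda_m\in\mathbb{Z}_+,\ x^1,\dots,x^m\in S\right\};$$ in particular $0\in\mathrm{mon}(S)$ always, even for $S=\emptyset$, via the empty decomposition. The monoid decomposition problem is: given (a presentation of) $S\subseteq\mathbb{Z}^d$ and $a\in\mathbb{Z}^d$, decide if $a\in\mathrm{mon}(S)$, and if yes, find a decomposition $a=\sum_k\lambda_k x^k$ with all $\lambda_k\in\mathbb{Z}_+$ and all $x^k\in S$. The decomposition is output as a finite list of pairs $(\lambda_k,x^k)$ with binary-encoded integer entries. *)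

theory Defs
  imports
    "Jordan_Normal_Form.Determinant"
    "Jordan_Normal_Form.DL_Submatrix"
    "HOL-Computational_Algebra.Polynomial"
    "HOL-Library.Log_Nat"
begin

section \<open>Matrices, polyhedra and generated monoids\<close>

definition totally_unimodular :: "int mat \<Rightarrow> bool" where
  "totally_unimodular A \<longleftrightarrow>
     (\<forall>I J. I \<subseteq> {..<dim_row A} \<longrightarrow> J \<subseteq> {..<dim_col A} \<longrightarrow> card I = card J \<longrightarrow>
        det (submatrix A I J) \<in> {-1, 0, 1})"

definition integer_points :: "int mat \<Rightarrow> int vec \<Rightarrow> int vec set" where
  "integer_points A b = {x \<in> carrier_vec (dim_col A). A *\<^sub>v x \<le> b}"

text \<open>The list \<open>[(\<lambda>\<^sub>1, x\<^sub>1), \<dots>, (\<lambda>\<^sub>m, x\<^sub>m)]\<close> stands for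
  \<open>\<lambda>\<^sub>1 x\<^sub>1 + \<dots> + \<lambda>\<^sub>m x\<^sub>m\<close>; the dimension \<open>d\<close> is needed for the empty list.\<close>

definition comb :: "nat \<Rightarrow> (nat \<times> int vec) list \<Rightarrow> int vec" where
  "comb d ps = foldr (\<lambda>(l, x) v. int l \<cdot>\<^sub>v x + v) ps (0\<^sub>v d)"

definition mon :: "nat \<Rightarrow> int vec set \<Rightarrow> int vec set" where
  "mon d S = {comb d ps |ps. snd ` set ps \<subseteq> S}"

section \<open>Random access machines with logarithmic cost\<close>

text \<open>
  Programs operate on integer registers that are addressed by integers (indirect addressing is
  allowed), on a read-only input tape and a write-only output tape, both holding integers.
  Control flow is structured instead of given by jumps.  Under the logarithmic cost
  criterion used here, every integer handled is charged its binary length.  A run of cost \<open>t\<close>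
  therefore touches at most \<open>t\<close> registers and only numbers of length at most \<open>t\<close>, and the model
  is polynomially equivalent to (multitape) Turing machines.
\<close>

text \<open>One sign bit and the binary digits of the absolute value.\<close>

definition bit_length :: "int \<Rightarrow> nat" where
  "bit_length n = 1 + floorlog 2 (nat \<bar>n\<bar>)"

datatype aexp =
    Const int
  | Mem aexp
  | Add aexp aexp
  | Sub aexp aexp
  | Mul aexp aexp
  | Div aexp aexp

datatype com =
    Skip
  | Store aexp aexp
  | Read aexp
  | Write aexp
  | Seq com com
  | IfPos aexp com com
  | WhilePos aexp com

type_synonym memory = "int \<Rightarrow> int"

fun aval :: "aexp \<Rightarrow> memory \<Rightarrow> int" where
  "aval (Const n) m = n"
| "aval (Mem e) m = m (aval e m)"
| "aval (Add e f) m = aval e m + aval f m"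
| "aval (Sub e f) m = aval e m - aval f m"
| "aval (Mul e f) m = aval e m * aval f m"
| "aval (Div e f) m = aval e m div aval f m"

text \<open>Each operation is charged the length of its result; the lengths of its operands are
  already part of the costs of the subexpressions.\<close>

fun acost :: "aexp \<Rightarrow> memory \<Rightarrow> nat" where
  "acost (Const n) m = bit_length n"
| "acost (Mem e) m = acost e m + bit_length (aval (Mem e) m)"
| "acost (Add e f) m = acost e m + acost f m + bit_length (aval (Add e f) m)"
| "acost (Sub e f) m = acost e m + acost f m + bit_length (aval (Sub e f) m)"
| "acost (Mul e f) m = acost e m + acost f m + bit_length (aval (Mul e f) m)"
| "acost (Div e f) m = acost e m + acost f m + bit_length (aval (Div e f) m)"

text \<open>A configuration consists of the memory, the unread input and the output written so far.
  \<open>exec c s t s'\<close> means that \<open>c\<close>, started in \<open>s\<close>, terminates in \<open>s'\<close> with total cost \<open>t\<close>.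
  Reading from an exhausted input tape gets stuck.\<close>

type_synonym config = "memory \<times> int list \<times> int list"

inductive exec :: "com \<Rightarrow> config \<Rightarrow> nat \<Rightarrow> config \<Rightarrow> bool" where
  Skip: "exec Skip s 1 s"
| Store: "exec (Store e f) (m, inp, out) (acost e m + acost f m) (m(aval e m := aval f m), inp, out)"
| Read: "exec (Read e) (m, x # inp, out) (acost e m + bit_length x) (m(aval e m := x), inp, out)"
| Write: "exec (Write e) (m, inp, out) (acost e m) (m, inp, out @ [aval e m])"
| Seq: "exec c s t s' \<Longrightarrow> exec c' s' t' s'' \<Longrightarrow> exec (Seq c c') s (t + t') s''"
| IfTrue: "aval e (fst s) > 0 \<Longrightarrow> exec c s t s' \<Longrightarrow> exec (IfPos e c c') s (acost e (fst s) + t) s'"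
| IfFalse: "\<not> aval e (fst s) > 0 \<Longrightarrow> exec c' s t s' \<Longrightarrow> exec (IfPos e c c') s (acost e (fst s) + t) s'"
| WhileTrue: "aval e (fst s) > 0 \<Longrightarrow> exec c s t s' \<Longrightarrow> exec (WhilePos e c) s' t' s'' \<Longrightarrow>
    exec (WhilePos e c) s (acost e (fst s) + t + t') s''"
| WhileFalse: "\<not> aval e (fst s) > 0 \<Longrightarrow> exec (WhilePos e c) s (acost e (fst s)) s"

inductive_cases exec_elims:
  "exec Skip s t s'"
  "exec (Store e f) s t s'"
  "exec (Read e) s t s'"
  "exec (Write e) s t s'"
  "exec (Seq c c') s t s'"
  "exec (IfPos e c c') s t s'"

inductive_cases exec_WhileE: "exec (WhilePos e c) s t s'"

lemma exec_deterministic: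
  "exec c s t s' \<Longrightarrow> exec c s u s'' \<Longrightarrow> u = t \<and> s'' = s'"
proof (induction arbitrary: u s'' rule: exec.induct)
  case (WhileTrue e s c t s' t' s'')
  from WhileTrue.prems show ?case
    by (rule exec_WhileE) (use WhileTrue in blast)+
next
  case (WhileFalse e s c)
  from WhileFalse.prems show ?case
    by (rule exec_WhileE) (use WhileFalse in auto)
qed (erule exec_elims; force)+

lemma bit_length_aval_le_acost: "bit_length (aval e m) \<le> acost e m"
  by (cases e) auto

definition computes :: "com \<Rightarrow> int list \<Rightarrow> nat \<Rightarrow> int list \<Rightarrow> bool" where
  "computes prog inp t out \<longleftrightarrow> (\<exists>m rest. exec prog (\<lambda>_. 0, inp, []) t (m, rest, out))"

section \<open>The monoid decomposition problem\<close>

definition entries :: "int mat \<Rightarrow> int vec \<Rightarrow> int vec \<Rightarrow> int list" where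
  "entries A b a = concat (mat_to_list A) @ list_of_vec b @ list_of_vec a"

definition encoding_length :: "int mat \<Rightarrow> int vec \<Rightarrow> int vec \<Rightarrow> nat" where
  "encoding_length A b a = sum_list (map bit_length (entries A b a))"

definition input_tape :: "int mat \<Rightarrow> int vec \<Rightarrow> int vec \<Rightarrow> int list" where
  "input_tape A b a = int (dim_row A) # int (dim_col A) # entries A b a"

definition encode_pairs :: "(nat \<times> int vec) list \<Rightarrow> int list" where
  "encode_pairs ps = concat (map (\<lambda>(l, x). int l # list_of_vec x) ps)"

text \<open>The answer no is \<open>[0]\<close>; the answer yes is \<open>1\<close> followed by the coefficients and vectors of
  a decomposition, each pair occupying \<open>d + 1\<close> cells.\<close>

definition solves_monoid_decomposition ::
    "nat \<Rightarrow> int vec set \<Rightarrow> int vec \<Rightarrow> int list \<Rightarrow> bool" where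
  "solves_monoid_decomposition d S a out \<longleftrightarrow>
     (if a \<in> mon d S
      then \<exists>ps. snd ` set ps \<subseteq> S \<and> a = comb d ps \<and> out = 1 # encode_pairs ps
      else out = [0])"

end

theory Submission
  imports Defs
begin

text \<open>
  By the integer decomposition property, \<open>a \<noteq> 0\<close> is a sum of integer points of \<open>{x. A x \<le> b}\<close> iff
  \<open>A a \<le> n b\<close> for some \<open>n \<ge> 1\<close>, and the least candidate for \<open>n\<close> is read off the rows with
  \<open>b\<^sub>i > 0\<close>; no linear program has to be solved.

  For the decomposition, let \<open>z = (A a, a)\<close>.  The rational point \<open>z / n\<close> is rounded to an integral
  point whose coordinates \<open>y\<^sub>i / n\<close> are all \<open>\<lfloor>z\<^sub>i / n\<rfloor>\<close> or \<open>\<lceil>z\<^sub>i / n\<rceil>\<close>: for every column in turn one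
  moves along it until a row on which it does not vanish becomes integral, and clears that row by a
  column operation.  Column operations preserve the maximal minors of the matrix with rows \<open>A, I\<close>
  up to sign, so all entries stay in \<open>{-1, 0, 1}\<close>, every move has integral length (in units of
  \<open>1 / n\<close>) and never passes an integer on any row.  Subtracting the rounded point with the greatest
  multiplicity \<open>\<lambda>\<close> that keeps every \<open>z\<^sub>i / n\<close> between its floor and its ceiling makes a further row
  integral, unless \<open>\<lambda> = n\<close>; hence there are at most \<open>c + d + 1\<close> summands.
\<close>

section \<open>A program calculus with static cost bounds\<close>

text \<open>No separate integer decomposition theorem is used: the main loop, started whenever
  \<open>A a \<le> n b\<close>, itself ends with a decomposition. The converse only looks at the
  total multiplicity of a given decomposition. A row with \<open>b_i \<le> 0\<close> gets no easier
  as n grows, so the least n >= 1 allowed by the rows with positive \<open>b_i\<close> decides all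
  rows at once; \<open>a = 0\<close> is the empty sum and is treated with n = 0.

  The scale n may be exponential in the input length, which forbids removing one summand at a time
  and is the reason for the multiplicities. To stay within the integers, rounding works on n times
  the point: an integer coordinate is then a multiple of n. The identity rows below A carry the
  coordinates, give every column a nonzero entry, and make every entry of the transformed matrix a
  maximal minor up to sign.

  For the running time, one bound on all memory cells and one on all iteration counts suffice: the
  program is fixed, so its cost is a polynomial in the iteration bound times the common length of
  the cells.\<close>

lemma bit_length_le_iff: "bit_length v \<le> Suc k \<longleftrightarrow> \<bar>v\<bar> < 2 ^ k"
proof -
  have "bit_length v \<le> Suc k \<longleftrightarrow> nat \<bar>v\<bar> < 2 ^ k"
    by (simp add: bit_length_def floorlog_le_iff)
  then show ?thesis
    by (simp add: nat_less_iff)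
qed

lemma abs_less_bit_length: "\<bar>v\<bar> < 2 ^ (bit_length v - 1)"
  using bit_length_le_iff[of v "bit_length v - 1"] by (simp add: bit_length_def)

lemma bit_length_pos: "0 < bit_length v"
  by (simp add: bit_length_def)

lemma bit_length_leI:
  assumes "\<bar>v\<bar> < 2 ^ k" "k < n" shows "bit_length v \<le> n"
  using assms bit_length_le_iff[of v k] by simp

lemma bit_length_mono: "\<bar>v\<bar> \<le> \<bar>w\<bar> \<Longrightarrow> bit_length v \<le> bit_length w"
  unfolding bit_length_def by (simp add: floorlog_mono)

lemma bit_length_add: "bit_length (v + w) \<le> bit_length v + bit_length w + 1"
proof (rule bit_length_leI)
  let ?a = "bit_length v - 1" and ?b = "bit_length w - 1"
  have "\<bar>v + w\<bar> < 2 ^ ?a + 2 ^ ?b"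
    using abs_less_bit_length[of v] abs_less_bit_length[of w] by linarith
  also have "\<dots> \<le> 2 ^ (?a + ?b) + 2 ^ (?a + ?b)"
    by (intro add_mono power_increasing) auto
  also have "\<dots> = 2 ^ (?a + ?b + 1)"
    by simp
  finally show "\<bar>v + w\<bar> < 2 ^ (?a + ?b + 1)" .
  show "?a + ?b + 1 < bit_length v + bit_length w + 1"
    using bit_length_pos[of v] bit_length_pos[of w] by linarith
qed

lemma bit_length_diff: "bit_length (v - w) \<le> bit_length v + bit_length w + 1"
  using bit_length_add[of v "- w"] by (simp add: bit_length_def)

lemma bit_length_mult: "bit_length (v * w) \<le> bit_length v + bit_length w + 1"
proof (rule bit_length_leI)
  let ?a = "bit_length v - 1" and ?b = "bit_length w - 1"
  show "\<bar>v * w\<bar> < 2 ^ (?a + ?b)"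
    unfolding abs_mult power_add
    by (rule mult_strict_mono'[OF abs_less_bit_length abs_less_bit_length]) auto
  show "?a + ?b < bit_length v + bit_length w + 1"
    using bit_length_pos[of v] bit_length_pos[of w] by linarith
qed

text \<open>Division by zero yields 0, so the bound holds for every divisor and \<open>Div\<close>
  can share the length estimate of the other operations.\<close>

lemma abs_div_le: "\<bar>v div w\<bar> \<le> \<bar>v :: int\<bar>"
proof (cases "w = 0")
  case False
  have *: "\<bar>v div w\<bar> \<le> \<bar>v\<bar>" if "w > 0" for v w :: int
  proof (cases "v \<ge> 0")
    case True
    then show ?thesis
      using that by (smt (verit) pos_imp_zdiv_nonneg_iff zdiv_mono2 div_by_1)
  next
    case False
    then have "v div w < 0" "v div 1 \<le> v div w"
      using that div_neg_pos_less0[of v w] zdiv_mono2_neg[of v 1 w] by auto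
    then show ?thesis by auto
  qed
  show ?thesis
    using *[of w v] *[of "- w" "- v"] False by (cases "w > 0") auto
qed auto

lemma bit_length_div: "bit_length (v div w) \<le> bit_length v + bit_length w + 1"
  using bit_length_mono[OF abs_div_le[of v w]] by linarith

text \<open>\<open>len_factor\<close> and \<open>cost_factor\<close> bound the length and the cost of an expression in units of a
  common bound on the lengths of all memory cells.\<close>

fun len_factor :: "aexp \<Rightarrow> nat" where
  "len_factor (Const n) = bit_length n"
| "len_factor (Mem e) = 1"
| "len_factor (Add e f) = len_factor e + len_factor f + 1"
| "len_factor (Sub e f) = len_factor e + len_factor f + 1"
| "len_factor (Mul e f) = len_factor e + len_factor f + 1"
| "len_factor (Div e f) = len_factor e + len_factor f + 1"

fun cost_factor :: "aexp \<Rightarrow> nat" where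
  "cost_factor (Const n) = len_factor (Const n)"
| "cost_factor (Mem e) = cost_factor e + len_factor (Mem e)"
| "cost_factor (Add e f) = cost_factor e + cost_factor f + len_factor (Add e f)"
| "cost_factor (Sub e f) = cost_factor e + cost_factor f + len_factor (Sub e f)"
| "cost_factor (Mul e f) = cost_factor e + cost_factor f + len_factor (Mul e f)"
| "cost_factor (Div e f) = cost_factor e + cost_factor f + len_factor (Div e f)"

text \<open>The same for commands, when no loop is iterated more than \<open>N\<close> times.\<close>

fun com_factor :: "nat \<Rightarrow> com \<Rightarrow> nat" where
  "com_factor N Skip = 1"
| "com_factor N (Store e f) = cost_factor e + cost_factor f"
| "com_factor N (Read e) = cost_factor e + 1"
| "com_factor N (Write e) = cost_factor e"
| "com_factor N (Seq c c') = com_factor N c + com_factor N c'"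
| "com_factor N (IfPos e c c') = cost_factor e + com_factor N c + com_factor N c'"
| "com_factor N (WhilePos e c) = (N + 1) * (cost_factor e + com_factor N c)"

text \<open>Each level of loop nesting contributes one factor \<open>N + 1\<close>, so the degree is
  the nesting depth of the program text.\<close>

lemma com_factor_poly: "\<exists>p :: nat poly. \<forall>N. com_factor N c = poly p N"
proof (induction c)
  case (Seq c c')
  then obtain p q :: "nat poly" where "\<forall>N. com_factor N c = poly p N" "\<forall>N. com_factor N c' = poly q N"
    by blast
  then show ?case by (intro exI[of _ "p + q"]) simp
next
  case (IfPos e c c')
  then obtain p q :: "nat poly" where "\<forall>N. com_factor N c = poly p N" "\<forall>N. com_factor N c' = poly q N"
    by blast
  then show ?case by (intro exI[of _ "[:cost_factor e:] + p + q"]) simp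
next
  case (WhilePos e c)
  then obtain p :: "nat poly" where "\<forall>N. com_factor N c = poly p N"
    by blast
  then show ?case by (intro exI[of _ "[:1, 1:] * ([:cost_factor e:] + p)"]) (simp add: algebra_simps)
next
  case Skip
  show ?case by (rule exI[of _ "[:1:]"]) simp
next
  case (Store e f)
  show ?case by (rule exI[of _ "[:cost_factor e + cost_factor f:]"]) simp
next
  case (Read e)
  show ?case by (rule exI[of _ "[:cost_factor e + 1:]"]) simp
next
  case (Write e)
  show ?case by (rule exI[of _ "[:cost_factor e:]"]) simp
qed

section \<open>Weakest preconditions with a built-in cost bound\<close>

locale resource_bounds =
  fixes N B :: nat and V :: int
  assumes B_pos: "0 < B" and bit_length_le_B: "\<And>v. \<bar>v\<bar> \<le> V \<Longrightarrow> bit_length v \<le> B"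
    and V_nonneg: "0 \<le> V"
begin

definition bounded :: "memory \<Rightarrow> bool" where
  "bounded m \<longleftrightarrow> (\<forall>x. \<bar>m x\<bar> \<le> V)"

text \<open>The cost bound depends on the program text alone, so it never appears in a proof
  obligation. Boundedness is assumed before and delivered after the run, so the rules pass it along
  by themselves.\<close>

definition wp :: "com \<Rightarrow> (config \<Rightarrow> bool) \<Rightarrow> config \<Rightarrow> bool" where
  "wp c Q s \<longleftrightarrow> (bounded (fst s) \<longrightarrow>
     (\<exists>t s'. exec c s t s' \<and> t \<le> com_factor N c * B \<and> bounded (fst s') \<and> Q s'))"

text \<open>Only stored values have to respect \<open>V\<close>. Intermediate results may exceed it,
  but their length grows at most additively with the expression.\<close>

lemma len_factor_bound:
  assumes "bounded m" shows "bit_length (aval e m) \<le> len_factor e * B"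
proof (induction e)
  case (Const x)
  show ?case using B_pos by simp
next
  case (Mem e)
  show ?case using assms bit_length_le_B by (simp add: bounded_def)
next
  case (Add e f)
  then show ?case using bit_length_add[of "aval e m" "aval f m"] B_pos by (simp add: algebra_simps)
next
  case (Sub e f)
  then show ?case using bit_length_diff[of "aval e m" "aval f m"] B_pos by (simp add: algebra_simps)
next
  case (Mul e f)
  then show ?case using bit_length_mult[of "aval e m" "aval f m"] B_pos by (simp add: algebra_simps)
next
  case (Div e f)
  then show ?case using bit_length_div[of "aval e m" "aval f m"] B_pos by (simp add: algebra_simps)
qed

lemma acost_bound:
  assumes "bounded m" shows "acost e m \<le> cost_factor e * B"
proof (induction e)
  case (Const x)
  show ?case using len_factor_bound[OF assms, of "Const x"] by simp
next
  case (Mem e)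
  then show ?case using len_factor_bound[OF assms, of "Mem e"] by (simp add: algebra_simps)
next
  case (Add e f)
  then show ?case using len_factor_bound[OF assms, of "Add e f"] by (simp add: algebra_simps)
next
  case (Sub e f)
  then show ?case using len_factor_bound[OF assms, of "Sub e f"] by (simp add: algebra_simps)
next
  case (Mul e f)
  then show ?case using len_factor_bound[OF assms, of "Mul e f"] by (simp add: algebra_simps)
next
  case (Div e f)
  then show ?case using len_factor_bound[OF assms, of "Div e f"] by (simp add: algebra_simps)
qed

lemma bounded_upd: "bounded m \<Longrightarrow> \<bar>v\<bar> \<le> V \<Longrightarrow> bounded (m(x := v))"
  by (simp add: bounded_def)

lemma wp_Skip: "Q s \<Longrightarrow> wp Skip Q s"
  unfolding wp_def using exec.Skip B_pos by fastforce

lemma wp_Store: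
  assumes "\<bar>aval f m\<bar> \<le> V" "Q (m(aval e m := aval f m), inp, out)"
  shows "wp (Store e f) Q (m, inp, out)"
  unfolding wp_def
proof (intro impI exI conjI)
  assume b: "bounded (fst (m, inp, out))"
  show "exec (Store e f) (m, inp, out) (acost e m + acost f m) (m(aval e m := aval f m), inp, out)"
    by (rule exec.Store)
  show "acost e m + acost f m \<le> com_factor N (Store e f) * B"
    using b acost_bound[of m e] acost_bound[of m f] by (simp add: algebra_simps)
qed (use assms in \<open>auto simp: bounded_upd\<close>)

lemma wp_Read:
  assumes "\<bar>x\<bar> \<le> V" "Q (m(aval e m := x), inp, out)"
  shows "wp (Read e) Q (m, x # inp, out)"
  unfolding wp_def
proof (intro impI exI conjI)
  assume b: "bounded (fst (m, x # inp, out))"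
  show "exec (Read e) (m, x # inp, out) (acost e m + bit_length x) (m(aval e m := x), inp, out)"
    by (rule exec.Read)
  show "acost e m + bit_length x \<le> com_factor N (Read e) * B"
    using b acost_bound[of m e] bit_length_le_B[OF assms(1)] by (simp add: algebra_simps)
qed (use assms in \<open>auto simp: bounded_upd\<close>)

lemma wp_Write:
  assumes "Q (m, inp, out @ [aval e m])"
  shows "wp (Write e) Q (m, inp, out)"
  unfolding wp_def
proof (intro impI exI conjI)
  assume b: "bounded (fst (m, inp, out))"
  show "exec (Write e) (m, inp, out) (acost e m) (m, inp, out @ [aval e m])"
    by (rule exec.Write)
  show "acost e m \<le> com_factor N (Write e) * B"
    using b acost_bound[of m e] by simp
qed (use assms in auto)

lemma wp_Seq:
  assumes "wp c (wp c' Q) s" shows "wp (Seq c c') Q s"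
  unfolding wp_def
proof
  assume "bounded (fst s)"
  then obtain t s' where s': "exec c s t s'" "t \<le> com_factor N c * B" "bounded (fst s')" "wp c' Q s'"
    using assms unfolding wp_def[of c] by blast
  then obtain t' s'' where "exec c' s' t' s''" "t' \<le> com_factor N c' * B" "bounded (fst s'')" "Q s''"
    unfolding wp_def by blast
  with s' show "\<exists>t s'. exec (Seq c c') s t s' \<and> t \<le> com_factor N (Seq c c') * B \<and> bounded (fst s') \<and> Q s'"
    using exec.Seq[of c s t s' c' t' s'']
    by (intro exI[of _ "t + t'"] exI[of _ s'']) (auto simp: algebra_simps)
qed

lemma wp_IfPos:
  assumes "aval e (fst s) > 0 \<Longrightarrow> wp c Q s" "\<not> aval e (fst s) > 0 \<Longrightarrow> wp c' Q s"
  shows "wp (IfPos e c c') Q s"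
  unfolding wp_def
proof
  assume b: "bounded (fst s)"
  note e = acost_bound[OF b, of e]
  show "\<exists>t s'. exec (IfPos e c c') s t s' \<and> t \<le> com_factor N (IfPos e c c') * B \<and> bounded (fst s') \<and> Q s'"
  proof (cases "aval e (fst s) > 0")
    case True
    with assms b obtain t s' where "exec c s t s'" "t \<le> com_factor N c * B" "bounded (fst s')" "Q s'"
      unfolding wp_def by blast
    with True e exec.IfTrue[of e s c t s' c'] show ?thesis
      by (intro exI[of _ "acost e (fst s) + t"] exI[of _ s']) (auto simp: algebra_simps)
  next
    case False
    with assms b obtain t s' where "exec c' s t s'" "t \<le> com_factor N c' * B" "bounded (fst s')" "Q s'"
      unfolding wp_def by blast
    with False e exec.IfFalse[of e s c' t s' c] show ?thesis
      by (intro exI[of _ "acost e (fst s) + t"] exI[of _ s']) (auto simp: algebra_simps)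
  qed
qed

lemma wp_mono: "wp c Q s \<Longrightarrow> (\<And>s'. bounded (fst s') \<Longrightarrow> Q s' \<Longrightarrow> R s') \<Longrightarrow> wp c R s"
  unfolding wp_def by blast

lemma wp_boundedI: "(bounded (fst s) \<Longrightarrow> wp c Q s) \<Longrightarrow> wp c Q s"
  unfolding wp_def by blast

text \<open>The index \<open>k\<close> of the invariant is a variant: it drops in every iteration
  and starts at most at \<open>N\<close>. The failed last test accounts for the \<open>N + 1\<close>
  in \<open>com_factor\<close>.\<close>

lemma wp_While:
  assumes step: "\<And>k s. I k s \<Longrightarrow> bounded (fst s) \<Longrightarrow> aval e (fst s) > 0 \<Longrightarrow> wp c (\<lambda>s'. \<exists>k'<k. I k' s') s"
    and stop: "\<And>k s. I k s \<Longrightarrow> \<not> aval e (fst s) > 0 \<Longrightarrow> Q s"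
    and init: "I k s" "k \<le> N"
  shows "wp (WhilePos e c) Q s"
proof -
  let ?u = "cost_factor e + com_factor N c"
  \<comment> \<open>Sharper than required so that the induction closes: at most k iterations plus
    one last test.\<close>
  have *: "\<exists>t s'. exec (WhilePos e c) s t s' \<and> t \<le> (k * ?u + cost_factor e) * B \<and> bounded (fst s') \<and> Q s'"
    if "bounded (fst s)" "I k s" for k s
    using that
  proof (induction k arbitrary: s rule: less_induct)
    case (less k)
    note e = acost_bound[OF less.prems(1), of e]
    show ?case
    proof (cases "aval e (fst s) > 0")
      case True
      then obtain t s' k' where s': "exec c s t s'" "t \<le> com_factor N c * B" "bounded (fst s')"
        "k' < k" "I k' s'"
        using step[OF less.prems(2,1)] less.prems(1) unfolding wp_def by blast
      with less.IH obtain t' s'' where s'': "exec (WhilePos e c) s' t' s''"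
        "t' \<le> (k' * ?u + cost_factor e) * B" "bounded (fst s'')" "Q s''"
        by blast
      have "acost e (fst s) + t + t' \<le> (Suc k' * ?u + cost_factor e) * B"
        using e s'(2) s''(2) by (simp add: algebra_simps)
      also have "\<dots> \<le> (k * ?u + cost_factor e) * B"
        using s'(4) by (intro mult_le_mono1 add_le_mono1) (simp add: Suc_le_eq)
      finally show ?thesis
        using exec.WhileTrue[OF True s'(1) s''(1)] s'' by blast
    next
      case False
      have "acost e (fst s) \<le> (k * ?u + cost_factor e) * B"
        using e by (simp add: algebra_simps)
      then show ?thesis
        using exec.WhileFalse[OF False] stop[OF less.prems(2) False] less.prems(1) by blast
    qed
  qed
  have "(k * ?u + cost_factor e) * B \<le> com_factor N (WhilePos e c) * B"
  proof (rule mult_le_mono1)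
    have "k * ?u \<le> N * ?u" using init(2) by (rule mult_le_mono1)
    then show "k * ?u + cost_factor e \<le> com_factor N (WhilePos e c)"
      unfolding com_factor.simps add_mult_distrib mult_1 by linarith
  qed
  with *[OF _ init(1)] show ?thesis
    unfolding wp_def using le_trans by blast
qed

end

subsection \<open>Arrays\<close>

text \<open>The memory is divided into 32 interleaved arrays, indexed by all integers; a scalar variable is
  the cell 0 of its array.\<close>

definition arr :: "memory \<Rightarrow> nat \<Rightarrow> int \<Rightarrow> int" where
  "arr m k i = m (32 * i + int k)"

definition upd :: "memory \<Rightarrow> nat \<Rightarrow> int \<Rightarrow> int \<Rightarrow> memory" where
  "upd m k i v = m(32 * i + int k := v)"

definition Cell :: "nat \<Rightarrow> aexp \<Rightarrow> aexp" where
  "Cell k e = Add (Mul (Const 32) e) (Const (int k))"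

abbreviation Arr :: "nat \<Rightarrow> aexp \<Rightarrow> aexp" where
  "Arr k e \<equiv> Mem (Cell k e)"

abbreviation Var :: "nat \<Rightarrow> aexp" where
  "Var k \<equiv> Arr k (Const 0)"

abbreviation var :: "memory \<Rightarrow> nat \<Rightarrow> int" where
  "var m k \<equiv> arr m k 0"

lemma aval_Cell: "aval (Cell k e) m = 32 * aval e m + int k"
  by (simp add: Cell_def)

lemma aval_Arr: "aval (Arr k e) m = arr m k (aval e m)"
  by (simp add: Cell_def arr_def)

declare aval.simps(2) [simp del]

text \<open>Addresses of array \<open>k\<close> are congruent to \<open>k\<close> modulo 32, so
  different arrays never share a cell, even at negative indices.\<close>

lemma arr_upd:
  "k < 32 \<Longrightarrow> l < 32 \<Longrightarrow> arr (upd m k i v) l j = (if k = l \<and> i = j then v else arr m l j)"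
  unfolding arr_def upd_def by (auto, presburger+)

definition frame :: "nat set \<Rightarrow> memory \<Rightarrow> memory \<Rightarrow> bool" where
  "frame X m m' \<longleftrightarrow> (\<forall>k<32. k \<notin> X \<longrightarrow> arr m' k = arr m k)"

definition modifies :: "nat set \<Rightarrow> com \<Rightarrow> bool" where
  "modifies X c \<longleftrightarrow> (\<forall>s t s'. exec c s t s' \<longrightarrow> frame X (fst s) (fst s'))"

lemma frame_refl: "frame X m m"
  by (simp add: frame_def)

lemma frame_trans: "frame X m m' \<Longrightarrow> frame Y m' m'' \<Longrightarrow> frame (X \<union> Y) m m''"
  by (simp add: frame_def)

lemma frame_mono: "frame X m m' \<Longrightarrow> X \<subseteq> Y \<Longrightarrow> frame Y m m'"
  by (auto simp: frame_def)

lemma frameD: "frame X m m' \<Longrightarrow> k < 32 \<Longrightarrow> k \<notin> X \<Longrightarrow> arr m' k = arr m k"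
  by (simp add: frame_def)

lemma frame_upd: "k < 32 \<Longrightarrow> k \<in> X \<Longrightarrow> frame X m (upd m k i v)"
  by (auto simp: frame_def arr_upd)

lemma modifies_Skip: "modifies X Skip"
  unfolding modifies_def by (auto elim: exec_elims simp: frame_refl)

lemma modifies_Store: "k < 32 \<Longrightarrow> k \<in> X \<Longrightarrow> modifies X (Store (Cell k e) f)"
  unfolding modifies_def
  by (auto elim!: exec_elims simp: aval_Cell frame_upd simp flip: upd_def)

lemma modifies_Read: "k < 32 \<Longrightarrow> k \<in> X \<Longrightarrow> modifies X (Read (Cell k e))"
  unfolding modifies_def
  by (auto elim!: exec_elims simp: aval_Cell frame_upd simp flip: upd_def)

lemma modifies_Write: "modifies X (Write e)"
  unfolding modifies_def by (auto elim!: exec_elims simp: frame_refl)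

lemma modifies_Seq: "modifies X c \<Longrightarrow> modifies X c' \<Longrightarrow> modifies X (Seq c c')"
  unfolding modifies_def by (auto elim!: exec_elims) (metis Un_absorb frame_trans fst_conv)

lemma modifies_IfPos: "modifies X c \<Longrightarrow> modifies X c' \<Longrightarrow> modifies X (IfPos e c c')"
  unfolding modifies_def by (auto elim!: exec_elims) (metis fst_conv)+

lemma modifies_WhilePos: "modifies X c \<Longrightarrow> modifies X (WhilePos e c)"
proof -
  assume c: "modifies X c"
  have "exec c' s t s' \<Longrightarrow> c' = WhilePos e c \<Longrightarrow> frame X (fst s) (fst s')" for c' s t s'
  proof (induction rule: exec.induct)
    case (WhileTrue e' s c'' t s' t' s'')
    then have "frame X (fst s) (fst s')" "frame X (fst s') (fst s'')"
      using c unfolding modifies_def by blast+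
    then show ?case using frame_trans by fastforce
  qed (auto simp: frame_refl)
  then show ?thesis unfolding modifies_def by blast
qed

lemmas modifies_intros = modifies_Skip modifies_Store modifies_Read modifies_Write modifies_Seq
  modifies_IfPos modifies_WhilePos

definition For :: "nat \<Rightarrow> aexp \<Rightarrow> com \<Rightarrow> com" where
  "For x e c = Seq (Store (Cell x (Const 0)) (Const 0))
     (WhilePos (Sub e (Var x)) (Seq c (Store (Cell x (Const 0)) (Add (Var x) (Const 1)))))"

lemma modifies_For: "x < 32 \<Longrightarrow> x \<in> X \<Longrightarrow> modifies X c \<Longrightarrow> modifies X (For x e c)"
  unfolding For_def by (intro modifies_intros)

section \<open>Framed rules for assignments and counted loops\<close>

context resource_bounds
begin

lemma wp_frame:
  assumes "wp c Q s" "modifies X c"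
  shows "wp c (\<lambda>s'. Q s' \<and> frame X (fst s) (fst s')) s"
  using assms unfolding wp_def modifies_def by blast

lemma bounded_arr: "bounded m \<Longrightarrow> \<bar>arr m k i\<bar> \<le> V"
  by (simp add: bounded_def arr_def)

lemma bounded_cell: "bounded m \<Longrightarrow> \<bar>v\<bar> \<le> V \<Longrightarrow> bounded (upd m k i v)"
  by (simp add: bounded_upd upd_def)

lemma wp_assign:
  assumes "\<bar>aval f m\<bar> \<le> V" "Q (upd m k (aval e m) (aval f m), inp, out)"
  shows "wp (Store (Cell k e) f) Q (m, inp, out)"
  using assms by (intro wp_Store) (simp_all add: aval_Cell upd_def)

lemma wp_read:
  assumes "\<bar>x\<bar> \<le> V" "Q (upd m k (aval e m) x, inp, out)"
  shows "wp (Read (Cell k e)) Q (m, x # inp, out)"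
  using assms by (intro wp_Read) (simp_all add: aval_Cell upd_def)

text \<open>The bound \<open>e\<close> is constant on all memories that differ from the first only
  in \<open>X\<close> and the counter, so there are exactly \<open>n\<close> iterations. The body is
  specified with the counter already advanced, so the invariant need not be shown stable under the
  increment separately.\<close>

lemma wp_For:
  assumes x: "x < 32" "x \<notin> X" and mod: "modifies X c"
    and bnd: "\<And>m'. frame (insert x X) m m' \<Longrightarrow> aval e m' = int n" and n: "n \<le> N" "int n \<le> V"
    and init: "I 0 (upd m x 0 0) inp out"
    and step: "\<And>i m' inp' out'. i < n \<Longrightarrow> I i m' inp' out' \<Longrightarrow> var m' x = int i \<Longrightarrow>
      frame (insert x X) m m' \<Longrightarrow> bounded m' \<Longrightarrow>
      wp c (\<lambda>(m'', inp'', out''). I (Suc i) (upd m'' x 0 (int (Suc i))) inp'' out'') (m', inp', out')"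
    and fin: "\<And>m' inp' out'. I n m' inp' out' \<Longrightarrow> frame (insert x X) m m' \<Longrightarrow> bounded m' \<Longrightarrow> Q (m', inp', out')"
  shows "wp (For x e c) Q (m, inp, out)"
  unfolding For_def
proof (rule wp_Seq, rule wp_assign)
  \<comment> \<open>The variant is the number \<open>n - i\<close> of iterations left; the frame
    relates the current memory to the one before the loop.\<close>
  define J where "J k = (\<lambda>(m', inp', out'). \<exists>i\<le>n. k = n - i \<and> I i m' inp' out' \<and> var m' x = int i \<and>
    frame (insert x X) m m' \<and> bounded m')" for k
  show "\<bar>aval (Const 0) m\<bar> \<le> V" using V_nonneg by simp
  show "wp (WhilePos (Sub e (Var x)) (Seq c (Store (Cell x (Const 0)) (Add (Var x) (Const 1))))) Q
     (upd m x (aval (Const 0) m) (aval (Const 0) m), inp, out)"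
  proof (rule wp_boundedI, rule wp_While[where I = J])
    assume b: "bounded (fst (upd m x (aval (Const 0) m) (aval (Const 0) m), inp, out))"
    show "J n (upd m x (aval (Const 0) m) (aval (Const 0) m), inp, out)"
      unfolding J_def using init b by (auto intro!: exI[of _ 0] simp: arr_upd x frame_upd)
    show "n \<le> N" by (rule n)
  next
    fix k s assume J: "J k s" and stop: "\<not> aval (Sub e (Var x)) (fst s) > 0"
    obtain m' inp' out' where s: "s = (m', inp', out')" by (cases s)
    with J obtain i where i: "i \<le> n" "I i m' inp' out'" "var m' x = int i"
      "frame (insert x X) m m'" "bounded m'"
      unfolding J_def by auto
    with stop s bnd have "i = n" by (auto simp: aval_Arr)
    then show "Q s" using fin i s by simp
  next
    fix k s assume J: "J k s" and go: "aval (Sub e (Var x)) (fst s) > 0"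
    obtain m' inp' out' where s: "s = (m', inp', out')" by (cases s)
    with J obtain i where i: "i \<le> n" "I i m' inp' out'" "var m' x = int i"
      "frame (insert x X) m m'" "bounded m'" "k = n - i"
      unfolding J_def by auto
    with go s bnd have "i < n" by (auto simp: aval_Arr)
    show "wp (Seq c (Store (Cell x (Const 0)) (Add (Var x) (Const 1)))) (\<lambda>s'. \<exists>k'<k. J k' s') s"
    proof (rule wp_Seq, rule wp_mono[OF wp_frame[OF _ mod]])
      show "wp c (\<lambda>(m'', inp'', out''). I (Suc i) (upd m'' x 0 (int (Suc i))) inp'' out'') s"
        unfolding s using step[OF \<open>i < n\<close>] i by blast
      fix s'
      assume b: "bounded (fst s')" and
        P: "(case s' of (m'', inp'', out'') \<Rightarrow> I (Suc i) (upd m'' x 0 (int (Suc i))) inp'' out'') \<and>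
          frame X (fst s) (fst s')"
      obtain m'' inp'' out'' where s': "s' = (m'', inp'', out'')" by (cases s')
      have fr: "frame X m' m''" using P s s' by simp
      then have v: "var m'' x = int i" using i(3) x by (simp add: frameD)
      have fr': "frame (insert x X) m (upd m'' x 0 (int (Suc i)))"
        using frame_trans[OF frame_trans[OF i(4) fr] frame_upd[of x "insert x X"]] x
        by (auto elim: frame_mono)
      have V: "\<bar>int (Suc i)\<bar> \<le> V" using \<open>i < n\<close> n by simp
      show "wp (Store (Cell x (Const 0)) (Add (Var x) (Const 1))) (\<lambda>s'. \<exists>k'<k. J k' s') s'"
        unfolding s'
      proof (rule wp_boundedI, rule wp_assign)
        show "\<bar>aval (Add (Var x) (Const 1)) m''\<bar> \<le> V"
          using v V by (simp add: aval_Arr)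
        have "J (n - Suc i) (upd m'' x 0 (int (Suc i)), inp'', out'')"
          unfolding J_def using \<open>i < n\<close> P s' fr' b V x
          by (auto intro!: exI[of _ "Suc i"] simp: arr_upd bounded_cell simp del: of_nat_Suc)
        moreover have "aval (Add (Var x) (Const 1)) m'' = int (Suc i)"
          using v by (simp add: aval_Arr)
        ultimately show "\<exists>k'<k. J k' (upd m'' x (aval (Const 0) m'') (aval (Add (Var x) (Const 1)) m''),
            inp'', out'')"
          using i(6) \<open>i < n\<close> by (intro exI[of _ "n - Suc i"]) (simp add: add.commute)
      qed
    qed
  qed
qed

end

section \<open>Minors of totally unimodular matrices\<close>

text \<open>Rows and columns are chosen by functions instead of sets, so that one row can be
  exchanged by a function update. Order then only affects the sign, and a repetition gives
  zero.\<close>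

definition minor :: "(nat \<Rightarrow> nat \<Rightarrow> int) \<Rightarrow> nat \<Rightarrow> (nat \<Rightarrow> nat) \<Rightarrow> (nat \<Rightarrow> nat) \<Rightarrow> int" where
  "minor M k f g = det (mat k k (\<lambda>(i, j). M (f i) (g j)))"

text \<open>\<open>pick\<close> enumerates the image of \<open>f\<close> in increasing order, so
  \<open>\<pi> i\<close> is the rank of \<open>f i\<close> in that image.\<close>

lemma inj_eq_pick_permutes:
  assumes inj: "inj_on f {0..<k}"
  obtains \<pi> where "\<pi> permutes {0..<k}" "\<And>i. i < k \<Longrightarrow> pick (f ` {0..<k}) (\<pi> i) = f i"
proof -
  define \<pi> where "\<pi> i = (if i < k then card {a \<in> f ` {0..<k}. a < f i} else i)" for i
  have pick: "pick (f ` {0..<k}) (\<pi> i) = f i" if "i < k" for i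
    using that by (simp add: \<pi>_def pick_card_in_set)
  have "inj_on \<pi> {0..<k}"
  proof (rule inj_onI)
    fix i j assume ij: "i \<in> {0..<k}" "j \<in> {0..<k}" "\<pi> i = \<pi> j"
    then have "f i = f j" using pick[of i] pick[of j] by simp
    then show "i = j" using inj ij by (auto dest: inj_onD)
  qed
  moreover have "\<pi> ` {0..<k} \<subseteq> {0..<k}"
  proof safe
    fix i assume i: "i \<in> {0..<k}"
    have "{a \<in> f ` {0..<k}. a < f i} \<subset> f ` {0..<k}" using i by auto
    then have "card {a \<in> f ` {0..<k}. a < f i} < card (f ` {0..<k})"
      by (rule psubset_card_mono[rotated]) simp
    also have "\<dots> = k" using card_image[OF inj] by simp
    finally show "\<pi> i \<in> {0..<k}" using i by (simp add: \<pi>_def)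
  qed
  ultimately have "bij_betw \<pi> {0..<k} {0..<k}"
    by (simp add: bij_betw_def endo_inj_surj)
  then have "\<pi> permutes {0..<k}"
    by (rule bij_imp_permutes) (simp add: \<pi>_def)
  with that pick show thesis by blast
qed

lemma minor_transpose: "minor M k f g = minor (\<lambda>i j. M j i) k g f"
  unfolding minor_def
  by (subst det_transpose[symmetric, of _ k]) (auto intro!: arg_cong[where f = det] eq_matI)

lemma minor_permute_rows:
  assumes "\<pi> permutes {0..<k}" "\<And>i. i < k \<Longrightarrow> h (\<pi> i) = f i"
  shows "minor M k f g = signof \<pi> * minor M k h g"
proof -
  have "mat k k (\<lambda>(i, j). M (f i) (g j)) =
      mat k k (\<lambda>(i, j). mat k k (\<lambda>(i, j). M (h i) (g j)) $$ (\<pi> i, j))"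
    using assms(2) permutes_in_image[OF assms(1)] by (intro eq_matI) auto
  then show ?thesis
    using det_permute_rows[OF _ assms(1), of "mat k k (\<lambda>(i, j). M (h i) (g j))"]
    by (simp add: minor_def)
qed

lemma minor_not_inj_rows:
  assumes "\<not> inj_on f {0..<k}" shows "minor M k f g = 0"
proof -
  obtain i j where "i < k" "j < k" "i \<noteq> j" "f i = f j"
    using assms by (auto simp: inj_on_def)
  then show ?thesis
    unfolding minor_def by (intro det_identical_rows[of _ k i j]) (auto intro!: eq_vecI)
qed

lemma minor_not_inj_cols: "\<not> inj_on g {0..<k} \<Longrightarrow> minor M k f g = 0"
  by (subst minor_transpose) (rule minor_not_inj_rows)

text \<open>Connects the set-indexed submatrices of the definition with function-indexed minors:
  sorting rows and columns costs two signs, and a repeated index gives determinant 0.\<close>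

lemma minor_totally_unimodular:
  assumes TU: "totally_unimodular A" and A: "A \<in> carrier_mat c d"
    and f: "\<And>i. i < k \<Longrightarrow> f i < c" and g: "\<And>i. i < k \<Longrightarrow> g i < d"
  shows "minor (\<lambda>i j. A $$ (i, j)) k f g \<in> {-1, 0, 1}"
proof (cases "inj_on f {0..<k} \<and> inj_on g {0..<k}")
  case True
  define I J where "I = f ` {0..<k}" and "J = g ` {0..<k}"
  obtain \<pi> where \<pi>: "\<pi> permutes {0..<k}" "\<And>i. i < k \<Longrightarrow> pick I (\<pi> i) = f i"
    using True inj_eq_pick_permutes I_def by metis
  obtain \<rho> where \<rho>: "\<rho> permutes {0..<k}" "\<And>i. i < k \<Longrightarrow> pick J (\<rho> i) = g i"
    using True inj_eq_pick_permutes J_def by metis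
  have I: "I \<subseteq> {..<c}" "card I = k" and J: "J \<subseteq> {..<d}" "card J = k"
    using f g True by (auto simp: I_def J_def card_image)
  have "{i. i < c \<and> i \<in> I} = I" "{j. j < d \<and> j \<in> J} = J" using I J by auto
  then have "submatrix A I J = mat k k (\<lambda>(i, j). A $$ (pick I i, pick J j))"
    using A I J by (simp add: submatrix_def)
  moreover have "det (submatrix A I J) \<in> {-1, 0, 1}"
    using TU A I J unfolding totally_unimodular_def by auto
  ultimately have D: "minor (\<lambda>i j. A $$ (i, j)) k (pick I) (pick J) \<in> {-1, 0, 1}"
    by (simp add: minor_def)
  have eq: "minor (\<lambda>i j. A $$ (i, j)) k f g =
      signof \<pi> * (signof \<rho> * minor (\<lambda>i j. A $$ (i, j)) k (pick I) (pick J))"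
  proof -
    have "minor (\<lambda>i j. A $$ (i, j)) k f g = signof \<pi> * minor (\<lambda>i j. A $$ (i, j)) k (pick I) g"
      using \<pi> by (rule minor_permute_rows)
    also have "minor (\<lambda>i j. A $$ (i, j)) k (pick I) g = minor (\<lambda>j i. A $$ (i, j)) k g (pick I)"
      by (rule minor_transpose)
    also have "minor (\<lambda>j i. A $$ (i, j)) k g (pick I) =
        signof \<rho> * minor (\<lambda>j i. A $$ (i, j)) k (pick J) (pick I)"
      using \<rho> by (rule minor_permute_rows)
    also have "minor (\<lambda>j i. A $$ (i, j)) k (pick J) (pick I) =
        minor (\<lambda>i j. A $$ (i, j)) k (pick I) (pick J)"
      by (rule minor_transpose)
    finally show ?thesis .
  qed
  have "signof p * x \<in> {-1, 0, 1}" if "x \<in> {-1, 0, 1}" for p and x :: int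
    using that by (auto simp: sign_def)
  with D show ?thesis unfolding eq by blast
next
  case False
  then have "minor (\<lambda>i j. A $$ (i, j)) k f g = 0"
    using minor_not_inj_rows minor_not_inj_cols by blast
  then show ?thesis by simp
qed

definition append_id :: "int mat \<Rightarrow> nat \<Rightarrow> nat \<Rightarrow> int" where
  "append_id A i j = (if i < dim_row A then A $$ (i, j) else if i = dim_row A + j then 1 else 0)"

text \<open>Laplace expansion along a selected identity row. As the selected columns are distinct,
  this row has at most one nonzero entry, so the minor is 0 or, up to sign, a smaller minor; without
  identity rows it is a minor of \<open>A\<close>.\<close>

lemma minor_append_id:
  assumes TU: "totally_unimodular A" and A: "A \<in> carrier_mat c d"
    and f: "\<And>i. i < k \<Longrightarrow> f i < c + d" and g: "\<And>i. i < k \<Longrightarrow> g i < d" and inj: "inj_on g {..<k}"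
  shows "minor (append_id A) k f g \<in> {-1, 0, 1}"
  using f g inj
proof (induction k arbitrary: f g)
  case 0
  then show ?case by (simp add: minor_def)
next
  case (Suc k)
  show ?case
  proof (cases "\<forall>i<Suc k. f i < c")
    case True
    then have "minor (append_id A) (Suc k) f g = minor (\<lambda>i j. A $$ (i, j)) (Suc k) f g"
      unfolding minor_def using A by (intro arg_cong[where f = det] eq_matI) (auto simp: append_id_def)
    then show ?thesis
      using minor_totally_unimodular[OF TU A, of "Suc k" f g] True Suc.prems by simp
  next
    case False
    then obtain i where i: "i < Suc k" "c \<le> f i" by force
    let ?M = "mat (Suc k) (Suc k) (\<lambda>(i, j). append_id A (f i) (g j))"
    have det: "det ?M = (\<Sum>j<Suc k. ?M $$ (i, j) * cofactor ?M i j)"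
      using i by (intro laplace_expansion_row) auto
    have entry: "?M $$ (i, j) = (if f i = c + g j then 1 else 0)" if "j < Suc k" for j
      using that i A by (auto simp: append_id_def)
    show ?thesis
    proof (cases "\<exists>j<Suc k. f i = c + g j")
      case True
      then obtain j where j: "j < Suc k" "f i = c + g j" by blast
      have "?M $$ (i, l) * cofactor ?M i l = (if l = j then cofactor ?M i j else 0)" if "l < Suc k" for l
      proof -
        have "f i = c + g l \<longleftrightarrow> l = j"
          using j that Suc.prems(3) by (auto simp: inj_on_def)
        then show ?thesis using entry[OF that] by simp
      qed
      then have "det ?M = (\<Sum>l<Suc k. if l = j then cofactor ?M i j else 0)"
        unfolding det by (intro sum.cong) auto
      also have "\<dots> = cofactor ?M i j" using j by simp
      also have "\<dots> = (-1) ^ (i + j) *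
          minor (append_id A) k (\<lambda>l. f (insert_index i l)) (\<lambda>l. g (insert_index j l))"
        unfolding cofactor_def mat_delete_def insert_index_def minor_def
        by (intro arg_cong2[where f = "(*)"] arg_cong[where f = det] eq_matI) auto
      finally have "det ?M = (-1) ^ (i + j) *
          minor (append_id A) k (\<lambda>l. f (insert_index i l)) (\<lambda>l. g (insert_index j l))" .
      moreover have "minor (append_id A) k (\<lambda>l. f (insert_index i l)) (\<lambda>l. g (insert_index j l)) \<in> {-1, 0, 1}"
      proof (rule Suc.IH)
        show "inj_on (\<lambda>l. g (insert_index j l)) {..<k}"
        proof (rule inj_onI)
          fix x y assume xy: "x \<in> {..<k}" "y \<in> {..<k}" "g (insert_index j x) = g (insert_index j y)"
          then have "insert_index j x = insert_index j y"
            using inj_onD[OF Suc.prems(3) xy(3)] by (auto simp: insert_index_def)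
          then show "x = y" by (auto simp: insert_index_def split: if_splits)
        qed
      qed (use Suc.prems(1,2) in \<open>auto simp: insert_index_def\<close>)
      moreover have "(-1 :: int) ^ (i + j) \<in> {-1, 1}"
        by (cases "even (i + j)") auto
      ultimately show ?thesis unfolding minor_def[of _ "Suc k"] by auto
    next
      case False
      then have "det ?M = 0"
        unfolding det using entry by (intro sum.neutral) auto
      then show ?thesis by (simp add: minor_def)
    qed
  qed
qed

section \<open>Rounding to an integer point\<close>

text \<open>If the entry \<open>(p, j)\<close> is a sign, row \<open>p\<close> becomes a multiple of the \<open>j\<close>-th unit vector.\<close>

definition eliminate :: "nat \<Rightarrow> nat \<Rightarrow> (nat \<Rightarrow> nat \<Rightarrow> int) \<Rightarrow> nat \<Rightarrow> nat \<Rightarrow> int" where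
  "eliminate p j M i k = (if k = j then M i j else M i k - M i j * (M p k * M p j))"

text \<open>The column operation is right multiplication by an elementary matrix, which can be moved
  onto the coefficient vector, where it changes only the j-th coefficient. The next two lemmas
  conclude that the lattice spanned by the columns is unchanged.\<close>

lemma eliminate_mult:
  assumes "j < d"
  shows "(\<Sum>k<d. eliminate p j M i k * w k) =
    (\<Sum>k<d. M i k * (w(j := w j - (\<Sum>k\<in>{..<d} - {j}. M p k * M p j * w k))) k)"
proof -
  have *: "(\<Sum>k<d. h k) = h j + (\<Sum>k\<in>{..<d} - {j}. h k)" for h :: "nat \<Rightarrow> int"
    using assms by (intro sum.remove) auto
  show ?thesis
    unfolding *[of "\<lambda>k. eliminate p j M i k * w k"] *[of "\<lambda>k. M i k * (w(j := _)) k"]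
    by (simp add: eliminate_def algebra_simps sum_subtractf sum_distrib_left)
qed

lemma eliminate_lattice:
  assumes "j < d"
  shows "\<exists>v. \<forall>i. (\<Sum>k<d. eliminate p j M i k * w k) = (\<Sum>k<d. M i k * v k)"
  using eliminate_mult[OF assms] by blast

lemma eliminate_lattice':
  assumes "j < d"
  shows "\<exists>v. \<forall>i. (\<Sum>k<d. M i k * w k) = (\<Sum>k<d. eliminate p j M i k * v k)"
proof -
  let ?S = "\<Sum>k\<in>{..<d} - {j}. M p k * M p j * w k"
  \<comment> \<open>The inverse operation: the sum omits index j, so adding it back is undone
    exactly.\<close>
  let ?v = "w(j := w j + ?S)"
  have "(\<Sum>k\<in>{..<d} - {j}. M p k * M p j * ?v k) = ?S"
    by (intro sum.cong) auto
  then have *: "(?v(j := ?v j - (\<Sum>k\<in>{..<d} - {j}. M p k * M p j * ?v k))) = w"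
    by (auto simp: fun_eq_iff)
  have "(\<Sum>k<d. eliminate p j M i k * ?v k) = (\<Sum>k<d. M i k * w k)" for i
    by (simp only: eliminate_mult[OF assms] *)
  then show ?thesis by (intro exI[of _ ?v]) simp
qed

text \<open>A maximal minor uses all columns, so the column operation multiplies it by the
  determinant of an invertible integer matrix, which is 1 or -1.\<close>

lemma minor_eliminate:
  assumes "j < d"
  shows "\<bar>minor (eliminate p j M) d f id\<bar> = \<bar>minor M d f id\<bar>"
proof -
  \<comment> \<open>Right multiplication by \<open>E q\<close> subtracts \<open>q s\<close> times
    column j from every other column s; negating \<open>q\<close> gives the inverse.\<close>
  define E where "E q = mat d d (\<lambda>(r, s). if r = s then 1 else if r = j then - q s else (0 :: int))" for q
  let ?M = "\<lambda>M. mat d d (\<lambda>(i, j). M (f i) (id j)) :: int mat"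
  let ?q = "\<lambda>k. M p k * M p j"
  have E: "E q \<in> carrier_mat d d" for q by (simp add: E_def)
  have sum: "(\<Sum>k = 0..<d. u k * E q $$ (k, s)) = (if s = j then u j else u s - u j * q s)"
    if "s < d" for u q s
  proof -
    have "(\<Sum>k = 0..<d. u k * E q $$ (k, s)) =
        (\<Sum>k = 0..<d. (if k = s then u s else 0) + (if k = j then (if s = j then 0 else - u j * q s) else 0))"
      using that by (intro sum.cong) (auto simp: E_def)
    then show ?thesis
      using that assms by (simp add: sum.distrib)
  qed
  have "E (\<lambda>s. - ?q s) * E ?q = 1\<^sub>m d"
  proof (rule eq_matI)
    fix r s assume rs: "r < dim_row (1\<^sub>m d)" "s < dim_col (1\<^sub>m d)"
    then have "(E (\<lambda>s. - ?q s) * E ?q) $$ (r, s) = (\<Sum>k = 0..<d. E (\<lambda>s. - ?q s) $$ (r, k) * E ?q $$ (k, s))"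
      using E by (simp add: scalar_prod_def E_def)
    with rs sum[of s "\<lambda>k. E (\<lambda>s. - ?q s) $$ (r, k)" ?q]
    show "(E (\<lambda>s. - ?q s) * E ?q) $$ (r, s) = 1\<^sub>m d $$ (r, s)"
      using assms by (auto simp: E_def)
  qed (auto simp: E_def)
  then have "det (E (\<lambda>s. - ?q s)) * det (E ?q) = 1"
    using det_mult[OF E E, of "\<lambda>s. - ?q s" ?q] by simp
  then have unit: "\<bar>det (E ?q)\<bar> = 1"
    by (metis abs_zmult_eq_1 mult.commute abs_1)
  have "?M (eliminate p j M) = ?M M * E ?q"
  proof (rule eq_matI)
    fix r s assume "r < dim_row (?M M * E ?q)" "s < dim_col (?M M * E ?q)"
    then have rs: "r < d" "s < d" by (auto simp: E_def)
    then have "(?M M * E ?q) $$ (r, s) = (\<Sum>k = 0..<d. M (f r) k * E ?q $$ (k, s))"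
      by (simp add: scalar_prod_def E_def)
    with rs sum[of s "M (f r)" ?q] show "?M (eliminate p j M) $$ (r, s) = (?M M * E ?q) $$ (r, s)"
      by (simp add: eliminate_def)
  qed (auto simp: E_def)
  then have "det (?M (eliminate p j M)) = det (?M M) * det (E ?q)"
    using det_mult[of "?M M" d "E ?q"] E by simp
  with unit show ?thesis by (simp add: abs_mult minor_def)
qed

text \<open>Replacing the \<open>j\<close>-th of the unit rows selected by \<open>R\<close> by row \<open>i\<close> exhibits the entry
  \<open>(i, j)\<close> as a minor, up to sign.\<close>

lemma entry_eq_minor:
  assumes j: "j < d" and R: "\<And>k. k < d \<Longrightarrow> \<bar>M (R k) k\<bar> = 1"
    "\<And>k l. k < d \<Longrightarrow> l < d \<Longrightarrow> l \<noteq> k \<Longrightarrow> M (R k) l = 0"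
  shows "\<bar>minor M d (R(j := i)) id\<bar> = \<bar>M i j\<bar>"
proof -
  let ?X = "mat d d (\<lambda>(r, s). M ((R(j := i)) r) (id s))"
  have "det ?X = (\<Sum>r<d. ?X $$ (r, j) * cofactor ?X r j)"
    using j by (intro laplace_expansion_column) auto
  also have "\<dots> = (\<Sum>r<d. if r = j then M i j * cofactor ?X j j else 0)"
    using j R(2) by (intro sum.cong) auto
  also have "\<dots> = M i j * cofactor ?X j j" using j by simp
  finally have "\<bar>det ?X\<bar> = \<bar>M i j\<bar> * \<bar>det (mat_delete ?X j j)\<bar>"
    by (simp add: cofactor_def abs_mult power_abs)
  moreover have "\<bar>det (mat_delete ?X j j)\<bar> = 1"
  proof -
    let ?Y = "mat_delete ?X j j"
    have "det ?Y = prod_list (diag_mat ?Y)"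
      by (rule det_lower_triangular[where n = "d - 1"]) (use R j in \<open>auto simp: mat_delete_def\<close>)
    moreover have "\<bar>?Y $$ (r, r)\<bar> = 1" if "r < d - 1" for r
      using that R(1) by (auto simp: mat_delete_def)
    then have "\<forall>x\<in>set (diag_mat ?Y). \<bar>x\<bar> = 1"
      by (auto simp: diag_mat_def)
    moreover have "(\<forall>x\<in>set xs. \<bar>x\<bar> = 1) \<Longrightarrow> \<bar>prod_list xs\<bar> = (1 :: int)" for xs
      by (induction xs) (auto simp: abs_mult)
    ultimately show ?thesis by metis
  qed
  ultimately show ?thesis by (simp add: minor_def)
qed

text \<open>Columns below \<open>j\<close> have been treated: each of them has a unit row on which \<open>y\<close> is divisible
  by \<open>n\<close>, and later steps do not change \<open>y\<close> on that row.\<close>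

definition round_inv ::
    "nat \<Rightarrow> nat \<Rightarrow> int \<Rightarrow> (nat \<Rightarrow> nat \<Rightarrow> int) \<Rightarrow> (nat \<Rightarrow> int) \<Rightarrow> nat \<Rightarrow> (nat \<Rightarrow> nat \<Rightarrow> int) \<Rightarrow> (nat \<Rightarrow> int) \<Rightarrow> bool"
  where
  "round_inv m d n G z j M y \<longleftrightarrow>
    (\<forall>f. (\<forall>k<d. f k < m) \<longrightarrow> minor M d f id \<in> {-1, 0, 1}) \<and>
    (\<forall>w. \<exists>v. \<forall>i<m. (\<Sum>k<d. M i k * w k) = (\<Sum>k<d. G i k * v k)) \<and>
    (\<exists>w. \<forall>i<m. y i = (\<Sum>k<d. M i k * w k)) \<and>
    (\<exists>R. \<forall>k<d. R k < m \<and> \<bar>M (R k) k\<bar> = 1 \<and> (\<forall>l<d. l \<noteq> k \<longrightarrow> M (R k) l = 0) \<and>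
      (k < j \<longrightarrow> n dvd y (R k))) \<and>
    (\<forall>i<m. n * (z i div n) \<le> y i \<and> y i \<le> n * - (- z i div n))"

section \<open>The rounding invariant: consequences, start, step and end\<close>

lemma round_inv_entry:
  assumes "round_inv m d n G z j M y" "i < m" "k < d"
  shows "M i k \<in> {-1, 0, 1}"
proof -
  obtain R where R: "\<And>k. k < d \<Longrightarrow> R k < m" "\<And>k. k < d \<Longrightarrow> \<bar>M (R k) k\<bar> = 1"
    "\<And>k l. k < d \<Longrightarrow> l < d \<Longrightarrow> l \<noteq> k \<Longrightarrow> M (R k) l = 0"
    using assms(1) unfolding round_inv_def by blast
  have "minor M d (R(k := i)) id \<in> {-1, 0, 1}"
    using assms R(1) unfolding round_inv_def by auto
  with entry_eq_minor[where M = M and R = R and i = i, OF assms(3) R(2,3)] show ?thesis by auto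
qed

lemma round_inv_column:
  assumes "round_inv m d n G z j M y" "k < d"
  shows "\<exists>i<m. M i k \<noteq> 0"
  using assms unfolding round_inv_def by (metis abs_0 zero_neq_one)

lemma round_inv_bounds:
  assumes "round_inv m d n G z j M y" "i < m"
  shows "n * (z i div n) \<le> y i" "y i \<le> n * - (- z i div n)"
  using assms unfolding round_inv_def by blast+

text \<open>\<open>- (- z div n)\<close> is the ceiling of z / n, so the last conjunct places y / n
  between floor and ceiling of z / n. \<open>M\<close> and \<open>y\<close> agree with
  \<open>G\<close> and \<open>z\<close> only on the relevant indices because they will be read off
  the memory.\<close>

lemma round_inv_init:
  assumes "\<And>f. (\<And>k. k < d \<Longrightarrow> f k < m) \<Longrightarrow> minor G d f id \<in> {-1, 0, 1}"
    and "\<And>i. i < m \<Longrightarrow> z i = (\<Sum>k<d. G i k * w k)"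
    and "\<And>k. k < d \<Longrightarrow> R k < m" "\<And>k l. k < d \<Longrightarrow> l < d \<Longrightarrow> G (R k) l = (if l = k then 1 else 0)"
    and n: "0 < n"
    and M: "\<And>i k. i < m \<Longrightarrow> k < d \<Longrightarrow> M i k = G i k" and y: "\<And>i. i < m \<Longrightarrow> y i = z i"
  shows "round_inv m d n G z 0 M y"
  unfolding round_inv_def
proof (intro conjI allI impI)
  fix f :: "nat \<Rightarrow> nat" assume f: "\<forall>k<d. f k < m"
  then have "minor M d f id = minor G d f id"
    unfolding minor_def using M by (intro arg_cong[where f = det] eq_matI) auto
  then show "minor M d f id \<in> {-1, 0, 1}" using assms(1) f by simp
next
  fix w :: "nat \<Rightarrow> int"
  show "\<exists>v. \<forall>i<m. (\<Sum>k<d. M i k * w k) = (\<Sum>k<d. G i k * v k)"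
    using M by (intro exI[of _ w] allI impI sum.cong) auto
next
  show "\<exists>w. \<forall>i<m. y i = (\<Sum>k<d. M i k * w k)"
    using M y assms(2) by (intro exI[of _ w]) simp
next
  show "\<exists>R. \<forall>k<d. R k < m \<and> \<bar>M (R k) k\<bar> = 1 \<and> (\<forall>l<d. l \<noteq> k \<longrightarrow> M (R k) l = 0) \<and>
      (k < 0 \<longrightarrow> n dvd y (R k))"
    using assms(3,4) M by (intro exI[of _ R]) simp
next
  fix i assume i: "i < m"
  have "z i = n * (z i div n) + z i mod n" "- z i = n * (- z i div n) + (- z i) mod n"
    "n * - (- z i div n) = - (n * (- z i div n))"
    by simp_all
  moreover have "0 \<le> z i mod n" "0 \<le> (- z i) mod n" using n by simp_all
  ultimately show "n * (z i div n) \<le> y i" "y i \<le> n * - (- z i div n)"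
    unfolding y[OF i] by linarith+
qed

text \<open>\<open>(- v) mod n\<close> is the distance from v up to the next multiple of n, and
  \<open>u\<close> is such a multiple.\<close>

lemma mod_le_distance:
  fixes n u v :: int
  assumes "n dvd u" "v \<le> u" "0 < n"
  shows "(- v) mod n \<le> u - v"
proof -
  have "(- v) mod n = (u - v) mod n"
    using assms(1) by (metis mod_diff_left_eq dvd_imp_mod_0 diff_0)
  then show ?thesis
    using zmod_le_nonneg_dividend[of "u - v" n] assms by simp
qed

text \<open>For an entry 1 or -1 of column j, the residue in \<open>min\<close> is the distance that
  row can move, in its own direction, before meeting a multiple of n. The floor and ceiling bounds
  are multiples of n, so the shortest such distance violates none of them, and it makes row p
  divisible. Elimination then leaves row p only its entry in column j, which shields it from later
  moves.\<close>

lemma round_inv_step: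
  assumes inv: "round_inv m d n G z j M y" and n: "0 < n" and j: "j < d"
    and p: "p < m" "M p j \<noteq> 0" and t: "t = (- (M p j * y p)) mod n"
    and min: "\<And>i. i < m \<Longrightarrow> M i j \<noteq> 0 \<Longrightarrow> t \<le> (- (M i j * y i)) mod n"
    and y': "\<And>i. i < m \<Longrightarrow> y' i = y i + t * M i j"
    and M': "\<And>i k. i < m \<Longrightarrow> k < d \<Longrightarrow> M' i k = eliminate p j M i k"
  shows "round_inv m d n G z (Suc j) M' y'"
proof -
  obtain R where R: "\<And>k. k < d \<Longrightarrow> R k < m" "\<And>k. k < d \<Longrightarrow> \<bar>M (R k) k\<bar> = 1"
    "\<And>k l. k < d \<Longrightarrow> l < d \<Longrightarrow> l \<noteq> k \<Longrightarrow> M (R k) l = 0" "\<And>k. k < d \<Longrightarrow> k < j \<Longrightarrow> n dvd y (R k)"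
    using inv unfolding round_inv_def by blast
  obtain w where w: "\<And>i. i < m \<Longrightarrow> y i = (\<Sum>k<d. M i k * w k)"
    using inv unfolding round_inv_def by blast
  have entry: "M i k \<in> {-1, 0, 1}" if "i < m" "k < d" for i k
    using round_inv_entry[OF inv that] .
  have Mpj: "M p j * M p j = 1" "\<bar>M p j\<bar> = 1" using entry[OF p(1) j] p(2) by auto
  have M'_mult: "(\<Sum>k<d. M' i k * w k) = (\<Sum>k<d. eliminate p j M i k * w k)" if "i < m" for i w
    using that M' by (intro sum.cong) auto
  have "minor M' d f id \<in> {-1, 0, 1}" if f: "\<forall>k<d. f k < m" for f
  proof -
    have "minor M' d f id = minor (eliminate p j M) d f id"
      unfolding minor_def using f M' by (intro arg_cong[where f = det] eq_matI) auto
    moreover have "minor M d f id \<in> {-1, 0, 1}"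
      using inv f unfolding round_inv_def by blast
    ultimately show ?thesis
      using minor_eliminate[OF j, of p M f] by auto
  qed
  moreover have "\<exists>v. \<forall>i<m. (\<Sum>k<d. M' i k * w k) = (\<Sum>k<d. G i k * v k)" for w
  proof -
    obtain v where "\<forall>i. (\<Sum>k<d. eliminate p j M i k * w k) = (\<Sum>k<d. M i k * v k)"
      using eliminate_lattice[OF j] by blast
    moreover obtain u where "\<forall>i<m. (\<Sum>k<d. M i k * v k) = (\<Sum>k<d. G i k * u k)"
      using inv unfolding round_inv_def by blast
    ultimately show ?thesis using M'_mult by (intro exI[of _ u]) simp
  qed
  moreover have "\<exists>v. \<forall>i<m. y' i = (\<Sum>k<d. M' i k * v k)"
  proof -
    \<comment> \<open>A move of length t along column j adds t to the j-th coefficient.\<close>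
    have "y' i = (\<Sum>k<d. M i k * (w(j := w j + t)) k)" if "i < m" for i
    proof -
      have "(\<Sum>k<d. M i k * (w(j := w j + t)) k) = (\<Sum>k<d. M i k * w k + (if k = j then M i j * t else 0))"
        by (intro sum.cong) (auto simp: algebra_simps)
      then show ?thesis
        using that y' w j by (simp add: sum.distrib algebra_simps)
    qed
    moreover obtain v where "\<forall>i. (\<Sum>k<d. M i k * (w(j := w j + t)) k) = (\<Sum>k<d. eliminate p j M i k * v k)"
      using eliminate_lattice'[OF j] by blast
    ultimately show ?thesis using M'_mult by (intro exI[of _ v]) simp
  qed
  moreover have "\<exists>R'. \<forall>k<d. R' k < m \<and> \<bar>M' (R' k) k\<bar> = 1 \<and> (\<forall>l<d. l \<noteq> k \<longrightarrow> M' (R' k) l = 0) \<and>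
      (k < Suc j \<longrightarrow> n dvd y' (R' k))"
  proof (intro exI allI impI)
    fix k assume k: "k < d"
    \<comment> \<open>The pivot row takes over as the unit row of column j.\<close>
    show "(R(j := p)) k < m \<and> \<bar>M' ((R(j := p)) k) k\<bar> = 1 \<and> (\<forall>l<d. l \<noteq> k \<longrightarrow> M' ((R(j := p)) k) l = 0) \<and>
        (k < Suc j \<longrightarrow> n dvd y' ((R(j := p)) k))"
    proof (cases "k = j")
      case True
      have "M' p l = 0" if "l < d" "l \<noteq> j" for l
      proof -
        have "M' p l = M p l - M p l * (M p j * M p j)"
          using that M' p by (simp add: eliminate_def algebra_simps)
        then show ?thesis using Mpj by simp
      qed
      moreover have "n dvd y' p"
      proof -
        have "(M p j * y p + t) mod n = 0"
          unfolding t by (metis add.right_inverse mod_add_right_eq mod_0)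
        \<comment> \<open>The second factor \<open>M p j\<close> makes the square 1 appear and turns
          the sum into \<open>y' p\<close>.\<close>
        then have "n dvd M p j * (M p j * y p + t)"
          by (intro dvd_mult) (rule mod_0_imp_dvd)
        also have "M p j * (M p j * y p + t) = (M p j * M p j) * y p + t * M p j"
          by (simp add: algebra_simps)
        finally show ?thesis using y'[OF p(1)] Mpj by simp
      qed
      ultimately show ?thesis
        using True p j M' Mpj by (simp add: eliminate_def)
    next
      case False
      \<comment> \<open>A unit row of another column vanishes in column j, so neither the move nor
        the elimination touches it.\<close>
      then have "M (R k) j = 0" using R(3)[OF k j] by simp
      then show ?thesis
        using False k j R M' y' by (simp add: eliminate_def)
    qed
  qed
  moreover have "n * (z i div n) \<le> y' i \<and> y' i \<le> n * - (- z i div n)" if i: "i < m" for i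
  proof -
    note b = round_inv_bounds[OF inv i]
    have t0: "0 \<le> t" using t n by simp
    \<comment> \<open>\<open>u\<close> is for an entry 1, where y rises; \<open>l\<close> is for an
      entry -1, where y falls and the residue in \<open>min\<close> becomes
      \<open>y i mod n\<close>.\<close>
    have u: "(- y i) mod n \<le> n * - (- z i div n) - y i"
      using b n by (intro mod_le_distance) auto
    have l: "y i mod n \<le> y i - n * (z i div n)"
      using b n mod_le_distance[of n "- (n * (z i div n))" "- y i"] by simp
    show ?thesis
      using entry[OF i j] min[OF i] y'[OF i] b t0 u l by auto
  qed
  ultimately show ?thesis unfolding round_inv_def by blast
qed

text \<open>On the unit row of column k the value of y is plus or minus the coefficient
  \<open>w k\<close>. All d coefficients are therefore divisible by n, and with them every
  row.\<close>

lemma round_inv_final: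
  assumes inv: "round_inv m d n G z d M y"
  shows "\<And>i. i < m \<Longrightarrow> n dvd y i" and "\<exists>v. \<forall>i<m. y i = (\<Sum>k<d. G i k * v k)"
proof -
  obtain R where R: "\<And>k. k < d \<Longrightarrow> R k < m" "\<And>k. k < d \<Longrightarrow> \<bar>M (R k) k\<bar> = 1"
    "\<And>k l. k < d \<Longrightarrow> l < d \<Longrightarrow> l \<noteq> k \<Longrightarrow> M (R k) l = 0" "\<And>k. k < d \<Longrightarrow> n dvd y (R k)"
    using inv unfolding round_inv_def by blast
  obtain w where w: "\<And>i. i < m \<Longrightarrow> y i = (\<Sum>k<d. M i k * w k)"
    using inv unfolding round_inv_def by blast
  have "n dvd w k" if "k < d" for k
  proof -
    have "y (R k) = (\<Sum>l<d. if l = k then M (R k) k * w k else 0)"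
      unfolding w[OF R(1)[OF that]] using R(3)[OF that] by (intro sum.cong) auto
    then have "y (R k) = M (R k) k * w k" using that by simp
    then have "n dvd M (R k) k * w k" using R(4)[OF that] by simp
    then have "n dvd \<bar>M (R k) k\<bar> * \<bar>w k\<bar>" by (simp flip: abs_mult)
    then show ?thesis using R(2)[OF that] by simp
  qed
  then show "n dvd y i" if "i < m" for i
    unfolding w[OF that] by (intro dvd_sum) auto
  obtain v where "\<forall>i<m. (\<Sum>k<d. M i k * w k) = (\<Sum>k<d. G i k * v k)"
    using inv unfolding round_inv_def by blast
  with w show "\<exists>v. \<forall>i<m. y i = (\<Sum>k<d. G i k * v k)" by (intro exI[of _ v]) simp
qed

section \<open>Decomposition into integer points\<close>

text \<open>Write z = n f + r and y = n x with x = f or x = f + 1. The rest is (n - l) f plus r - l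
  (x - f), and the condition on l keeps the latter between 0 and n - l, so f and f + 1 still enclose
  the rest divided by n - l. When l is extreme, the latter hits an end and the row becomes
  integral.\<close>

lemma row_step:
  fixes z y n l :: int
  assumes n: "0 < n" and dvd: "n dvd y" and y: "n * (z div n) \<le> y" "y \<le> n * - (- z div n)"
    and l: "0 < l" "l \<le> n" "\<not> n dvd z \<Longrightarrow> l \<le> (if z < y then z mod n else n - z mod n)"
  defines "z' \<equiv> z - l * (y div n)"
  shows "n dvd z \<Longrightarrow> z' = (n - l) * (z div n)"
    and "\<not> n dvd z \<Longrightarrow> (n - l) * (z div n) \<le> z' \<and> z' \<le> (n - l) * (z div n + 1)"
    and "\<not> n dvd z \<Longrightarrow> y div n \<le> z div n + 1"
    and "n dvd z \<Longrightarrow> y div n = z div n"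
    and "\<not> n dvd z \<Longrightarrow> l = (if z < y then z mod n else n - z mod n) \<Longrightarrow> (n - l) dvd z'"
proof -
  define f r x where "f = z div n" and "r = z mod n" and "x = y div n"
  have z: "z = n * f + r" and r: "0 \<le> r" "r < n" and yx: "y = n * x"
    using n dvd by (auto simp: f_def r_def x_def)
  have dvd_iff: "n dvd z \<longleftrightarrow> r = 0" by (simp add: r_def dvd_eq_mod_eq_0)
  have ceil: "- (- z div n) = (if r = 0 then f else f + 1)"
    using n by (auto simp: f_def r_def zdiv_zminus1_eq_if)
  have "n * f \<le> n * x" using y(1) yx f_def by simp
  then have fx: "f \<le> x" using n by simp
  have "n * x \<le> n * (if r = 0 then f else f + 1)" using y(2) yx ceil by simp
  then have xf: "x \<le> (if r = 0 then f else f + 1)" using n by simp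
  \<comment> \<open>Comparing z with y tells whether the row was rounded up; this is the test made
    by the program.\<close>
  have less: "z < y \<longleftrightarrow> x = f + 1" if "r \<noteq> 0"
  proof -
    have "x = f \<or> x = f + 1" using fx xf that by auto
    then show ?thesis using z yx r that by (auto simp: algebra_simps)
  qed
  have z': "z' = (n - l) * f + (r - l * (x - f))"
    by (simp add: z'_def z flip: x_def) (simp add: algebra_simps)
  show "z' = (n - l) * (z div n)" "y div n = z div n" if "n dvd z"
    using that dvd_iff fx xf z' unfolding f_def[symmetric] x_def[symmetric] by auto
  show "y div n \<le> z div n + 1" if "\<not> n dvd z"
    using xf unfolding f_def[symmetric] x_def[symmetric] by (auto split: if_splits)
  have cases: "x = f + 1 \<and> l \<le> r \<or> x = f \<and> l \<le> n - r" if "\<not> n dvd z"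
    using that l(3) dvd_iff less fx xf unfolding r_def[symmetric] by (auto split: if_splits)
  show "(n - l) * (z div n) \<le> z' \<and> z' \<le> (n - l) * (z div n + 1)" if "\<not> n dvd z"
    unfolding f_def[symmetric] z' using cases[OF that] r by (auto simp: algebra_simps)
  show "(n - l) dvd z'" if "\<not> n dvd z" and "l = (if z < y then z mod n else n - z mod n)"
  proof -
    have "r - l * (x - f) = 0 \<or> r - l * (x - f) = n - l"
      using that dvd_iff less fx xf unfolding r_def[symmetric] by (auto split: if_splits)
    then have "(n - l) dvd (r - l * (x - f))"
      by (elim disjE) (simp_all only: dvd_0_right dvd_refl)
    then show ?thesis unfolding z' by (intro dvd_add dvd_triv_left)
  qed
qed

text \<open>\<open>z\<close> holds the values of the constraint rows, followed by the coordinates, of the part of the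
  vector that has not been decomposed yet; it is to be a sum of \<open>n\<close> integer points.\<close>

definition dec_inv :: "int mat \<Rightarrow> int vec \<Rightarrow> int \<Rightarrow> int \<Rightarrow> (nat \<Rightarrow> int) \<Rightarrow> bool" where
  "dec_inv A b F n z \<longleftrightarrow> 0 \<le> n \<and>
    (\<forall>i<dim_row A + dim_col A. z i = (\<Sum>k<dim_col A. append_id A i k * z (dim_row A + k)) \<and> \<bar>z i\<bar> \<le> n * F) \<and>
    (\<forall>i<dim_row A. z i \<le> n * b $ i)"

definition fractional_rows :: "nat \<Rightarrow> int \<Rightarrow> (nat \<Rightarrow> int) \<Rightarrow> nat set" where
  "fractional_rows m n z = {i. i < m \<and> \<not> n dvd z i}"

text \<open>The bounds \<open>b $ i\<close>, \<open>F\<close> and \<open>- F\<close> on the rows of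
  z / n are integers, so they also hold for floors and ceilings, and thus for the rounded point and
  for the rest relative to its new scale. If l < n, it was determined by some fractional row, which
  becomes integral.\<close>

lemma dec_step:
  assumes inv: "dec_inv A b F n z" and n: "0 < n"
    and round: "round_inv (dim_row A + dim_col A) (dim_col A) n (append_id A) z (dim_col A) M y"
    and l: "0 < l" "l \<le> n"
      "\<And>i. i \<in> fractional_rows (dim_row A + dim_col A) n z \<Longrightarrow>
        l \<le> (if z i < y i then z i mod n else n - z i mod n)"
      "l = n \<or> (\<exists>i\<in>fractional_rows (dim_row A + dim_col A) n z.
        l = (if z i < y i then z i mod n else n - z i mod n))"
    and z': "\<And>i. i < dim_row A + dim_col A \<Longrightarrow> z' i = z i - l * (y i div n)"
  shows "dec_inv A b F (n - l) z'"
    and "\<And>i. i < dim_row A \<Longrightarrow> y i div n \<le> b $ i"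
    and "\<And>i. i < dim_row A + dim_col A \<Longrightarrow>
      y i div n = (\<Sum>k<dim_col A. append_id A i k * (y (dim_row A + k) div n))"
    and "l \<noteq> n \<Longrightarrow> card (fractional_rows (dim_row A + dim_col A) (n - l) z') <
      card (fractional_rows (dim_row A + dim_col A) n z)"
proof -
  let ?m = "dim_row A + dim_col A" and ?c = "dim_row A" and ?d = "dim_col A"
  have frac: "\<not> n dvd z i \<Longrightarrow> i < ?m \<Longrightarrow> i \<in> fractional_rows ?m n z" for i
    by (simp add: fractional_rows_def)
  have dvd: "n dvd y i" if "i < ?m" for i using round_inv_final(1)[OF round that] .
  obtain v where v: "\<And>i. i < ?m \<Longrightarrow> y i = (\<Sum>k<?d. append_id A i k * v k)"
    using round_inv_final(2)[OF round] by blast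
  \<comment> \<open>On the identity rows a lattice coefficient is just a coordinate of y.\<close>
  have vk: "v k = y (?c + k)" if k: "k < ?d" for k
  proof -
    have "y (?c + k) = (\<Sum>l<?d. append_id A (?c + k) l * v l)"
      using k by (intro v) simp
    also have "\<dots> = (\<Sum>l<?d. if l = k then v k else 0)"
      by (intro sum.cong) (auto simp: append_id_def)
    finally show ?thesis using k by simp
  qed
  \<comment> \<open>All rows of y are divisible by n, so the linear relations survive
    division.\<close>
  show ydiv: "y i div n = (\<Sum>k<?d. append_id A i k * (y (?c + k) div n))" if i: "i < ?m" for i
  proof -
    have "y i = (\<Sum>k<?d. append_id A i k * y (?c + k))"
      unfolding v[OF i] using vk by (intro sum.cong) auto
    also have "\<dots> = (\<Sum>k<?d. n * (append_id A i k * (y (?c + k) div n)))"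
      using dvd by (intro sum.cong) (simp_all add: mult.left_commute[of n])
    finally have "y i = n * (\<Sum>k<?d. append_id A i k * (y (?c + k) div n))"
      by (simp add: sum_distrib_left)
    then show ?thesis using n by simp
  qed
  have row: "n dvd z i \<Longrightarrow> z' i = (n - l) * (z i div n)"
    "\<not> n dvd z i \<Longrightarrow> (n - l) * (z i div n) \<le> z' i \<and> z' i \<le> (n - l) * (z i div n + 1)"
    "\<not> n dvd z i \<Longrightarrow> y i div n \<le> z i div n + 1"
    "n dvd z i \<Longrightarrow> y i div n = z i div n"
    "\<not> n dvd z i \<Longrightarrow> l = (if z i < y i then z i mod n else n - z i mod n) \<Longrightarrow> (n - l) dvd z' i"
    if i: "i < ?m" for i
    unfolding z'[OF i]
    using row_step[OF n dvd[OF i] round_inv_bounds[OF round i] l(1,2) l(3)[OF frac[OF _ i]]] by blast+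
  have zdiv: "z i div n * n \<le> z i" for i
    using n by (simp add: minus_mod_eq_div_mult[symmetric])
  \<comment> \<open>In a fractional row z / n lies strictly below the integer bound, which leaves
    room for the ceiling.\<close>
  have zb: "z i div n \<le> b $ i" "\<not> n dvd z i \<Longrightarrow> z i div n + 1 \<le> b $ i" if i: "i < ?c" for i
  proof -
    have le: "z i \<le> n * b $ i" using inv i unfolding dec_inv_def by blast
    then have "n * (z i div n) \<le> n * b $ i" using zdiv[of i] by (simp add: mult.commute)
    then show "z i div n \<le> b $ i" using n by simp
    assume "\<not> n dvd z i"
    then have "z i div n * n \<noteq> z i" by (metis dvd_triv_right)
    then have "n * (z i div n) < n * b $ i" using le zdiv[of i] by (simp add: mult.commute)
    then show "z i div n + 1 \<le> b $ i" using n by simp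
  qed
  have zF: "- F \<le> z i div n" "z i div n \<le> F" "\<not> n dvd z i \<Longrightarrow> z i div n + 1 \<le> F" if i: "i < ?m" for i
  proof -
    have le: "\<bar>z i\<bar> \<le> n * F" using inv i unfolding dec_inv_def by blast
    then have "n * (z i div n) \<le> n * F" using zdiv[of i] by (simp add: mult.commute)
    then show "z i div n \<le> F" using n by simp
    have "(- F * n) div n \<le> z i div n" using le n by (intro zdiv_mono1) (auto simp: mult.commute)
    then show "- F \<le> z i div n" using n by (subst (asm) nonzero_mult_div_cancel_right) auto
    assume "\<not> n dvd z i"
    then have "z i div n * n \<noteq> z i" by (metis dvd_triv_right)
    then have "n * (z i div n) < n * F" using le zdiv[of i] by (simp add: mult.commute)
    then show "z i div n + 1 \<le> F" using n by simp
  qed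
  show yb: "y i div n \<le> b $ i" if i: "i < ?c" for i
    using row(3,4)[of i] zb[OF i] i by (cases "n dvd z i") auto
  have nl: "0 \<le> n - l" using l by simp
  show "dec_inv A b F (n - l) z'"
    unfolding dec_inv_def
  proof (intro conjI allI impI)
    show "0 \<le> n - l" by (rule nl)
  next
    fix i assume i: "i < ?m"
    have "z i = (\<Sum>k<?d. append_id A i k * z (?c + k))" using inv i unfolding dec_inv_def by blast
    then have "z' i = (\<Sum>k<?d. append_id A i k * z (?c + k)) -
        l * (\<Sum>k<?d. append_id A i k * (y (?c + k) div n))"
      using z'[OF i] ydiv[OF i] by simp
    also have "\<dots> = (\<Sum>k<?d. append_id A i k * (z (?c + k) - l * (y (?c + k) div n)))"
      by (simp add: algebra_simps sum_subtractf sum_distrib_left)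
    also have "\<dots> = (\<Sum>k<?d. append_id A i k * z' (?c + k))"
      using z' by (intro sum.cong) auto
    finally show "z' i = (\<Sum>k<?d. append_id A i k * z' (?c + k))" .
    show "\<bar>z' i\<bar> \<le> (n - l) * F"
    proof (cases "n dvd z i")
      case True
      have "\<bar>z i div n\<bar> \<le> F" using zF[OF i] by auto
      then have "(n - l) * \<bar>z i div n\<bar> \<le> (n - l) * F" using nl by (rule mult_left_mono)
      then show ?thesis using row(1)[OF i] i True nl by (simp add: abs_mult)
    next
      case False
      have "(n - l) * (z i div n + 1) \<le> (n - l) * F" "(n - l) * (- F) \<le> (n - l) * (z i div n)"
        by (rule mult_left_mono[OF _ nl], use zF[OF i] False in simp)+
      then show ?thesis using row(2)[of i] i False by (auto simp: abs_le_iff)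
    qed
  next
    fix i assume i: "i < ?c"
    show "z' i \<le> (n - l) * b $ i"
    proof (cases "n dvd z i")
      case True
      have "(n - l) * (z i div n) \<le> (n - l) * b $ i" using zb(1)[OF i] nl by (rule mult_left_mono)
      then show ?thesis using row(1)[of i] i True by simp
    next
      case False
      have "(n - l) * (z i div n + 1) \<le> (n - l) * b $ i" using zb(2)[OF i False] nl by (rule mult_left_mono)
      then show ?thesis using row(2)[of i] i False by simp
    qed
  qed
  assume "l \<noteq> n"
  then obtain i where i: "i \<in> fractional_rows ?m n z" "l = (if z i < y i then z i mod n else n - z i mod n)"
    using l(4) by blast
  \<comment> \<open>An integral row stays integral: its rest is \<open>n - l\<close> times the old
    quotient.\<close>
  have "fractional_rows ?m (n - l) z' \<subseteq> fractional_rows ?m n z"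
    using row(1) by (auto simp: fractional_rows_def)
  moreover have "i \<notin> fractional_rows ?m (n - l) z'"
    using row(5)[of i] i by (auto simp: fractional_rows_def)
  ultimately have "fractional_rows ?m (n - l) z' \<subset> fractional_rows ?m n z" using i(1) by blast
  then show "card (fractional_rows ?m (n - l) z') < card (fractional_rows ?m n z)"
    by (rule psubset_card_mono[rotated]) (simp add: fractional_rows_def)
qed

section \<open>Nonnegative combinations and the necessary condition for membership\<close>

lemma comb_carrier: "snd ` set ps \<subseteq> carrier_vec d \<Longrightarrow> comb d ps \<in> carrier_vec d"
  by (induction ps) (auto simp: comb_def)

lemma comb_Cons: "comb d ((l, x) # ps) = int l \<cdot>\<^sub>v x + comb d ps"
  by (simp add: comb_def)

lemma comb_index:
  assumes "snd ` set ps \<subseteq> carrier_vec d" "k < d"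
  shows "comb d ps $ k = (\<Sum>(l, x)\<leftarrow>ps. int l * x $ k)"
  using assms
proof (induction ps)
  case (Cons p ps)
  obtain l x where "p = (l, x)" by (cases p)
  with Cons show ?case
    using comb_carrier[of ps d] by (auto simp: comb_Cons)
qed (simp add: comb_def)

lemma mult_mat_vec_index:
  fixes A :: "int mat"
  assumes "x \<in> carrier_vec (dim_col A)" "i < dim_row A"
  shows "(A *\<^sub>v x) $ i = (\<Sum>k<dim_col A. A $$ (i, k) * x $ k)"
  using assms by (simp add: scalar_prod_def atLeast0LessThan)

lemma integer_points_iff:
  assumes "x \<in> carrier_vec (dim_col A)" "b \<in> carrier_vec (dim_row A)"
  shows "x \<in> integer_points A b \<longleftrightarrow> (\<forall>i<dim_row A. (\<Sum>k<dim_col A. A $$ (i, k) * x $ k) \<le> b $ i)"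
proof -
  have "x \<in> integer_points A b \<longleftrightarrow> (\<forall>i<dim_row A. (A *\<^sub>v x) $ i \<le> b $ i)"
    using assms by (simp add: integer_points_def less_eq_vec_def)
  then show ?thesis using mult_mat_vec_index[OF assms(1)] by simp
qed

lemma comb_bound:
  assumes ps: "snd ` set ps \<subseteq> integer_points A b" and b: "b \<in> carrier_vec (dim_row A)" and i: "i < dim_row A"
  shows "(\<Sum>k<dim_col A. A $$ (i, k) * comb (dim_col A) ps $ k) \<le> (\<Sum>(l, x)\<leftarrow>ps. int l) * b $ i"
  using ps
proof (induction ps)
  case Nil
  then show ?case by (simp add: comb_def)
next
  case (Cons p ps)
  obtain l x where p: "p = (l, x)" by (cases p)
  have x: "x \<in> integer_points A b" and ps: "snd ` set ps \<subseteq> integer_points A b"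
    using Cons.prems p by auto
  then have xc: "x \<in> carrier_vec (dim_col A)" and psc: "snd ` set ps \<subseteq> carrier_vec (dim_col A)"
    by (auto simp: integer_points_def)
  have "(\<Sum>k<dim_col A. A $$ (i, k) * comb (dim_col A) (p # ps) $ k) =
      (\<Sum>k<dim_col A. int l * (A $$ (i, k) * x $ k) + A $$ (i, k) * comb (dim_col A) ps $ k)"
    using comb_carrier[OF psc] xc by (intro sum.cong) (auto simp: p comb_Cons algebra_simps)
  also have "\<dots> = int l * (\<Sum>k<dim_col A. A $$ (i, k) * x $ k) +
      (\<Sum>k<dim_col A. A $$ (i, k) * comb (dim_col A) ps $ k)"
    by (simp add: sum.distrib sum_distrib_left)
  also have "\<dots> \<le> int l * b $ i + (\<Sum>(l, x)\<leftarrow>ps. int l) * b $ i"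
    using Cons.IH[OF ps] x xc b i by (intro add_mono mult_left_mono) (auto simp: integer_points_iff)
  also have "\<dots> = (\<Sum>(l, x)\<leftarrow>p # ps. int l) * b $ i"
    by (simp add: p algebra_simps)
  finally show ?case .
qed

text \<open>The scale is the total multiplicity of a decomposition, by summing the constraints.
  Total multiplicity 0 forces all coefficients to vanish, which is why the zero vector is a case of
  its own.\<close>

lemma mon_scale:
  assumes a: "a \<in> mon (dim_col A) (integer_points A b)" and b: "b \<in> carrier_vec (dim_row A)"
  shows "a = 0\<^sub>v (dim_col A) \<or>
    (\<exists>n::int>0. \<forall>i<dim_row A. (\<Sum>k<dim_col A. A $$ (i, k) * a $ k) \<le> n * b $ i)"
proof -
  obtain ps where ps: "snd ` set ps \<subseteq> integer_points A b" "a = comb (dim_col A) ps"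
    using a unfolding mon_def by blast
  then have psc: "snd ` set ps \<subseteq> carrier_vec (dim_col A)" by (auto simp: integer_points_def)
  define n where "n = (\<Sum>(l, x)\<leftarrow>ps. int l)"
  have n0: "n \<ge> 0" unfolding n_def by (induction ps) auto
  show ?thesis
  proof (cases "n = 0")
    case True
    have "(\<Sum>(l, x)\<leftarrow>ps. int l) = 0 \<Longrightarrow> \<forall>(l, x)\<in>set ps. l = 0"
    proof (induction ps)
      case (Cons p ps)
      have "(\<Sum>(l, x)\<leftarrow>ps. int l) \<ge> 0" by (induction ps) auto
      with Cons show ?case by (auto split: prod.splits)
    qed simp
    then have *: "\<forall>(l, x)\<in>set ps. l = 0" using True n_def by simp
    have "a $ k = 0" if "k < dim_col A" for k
    proof -
      have "(\<Sum>(l, x)\<leftarrow>ps. int l * x $ k) = 0"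
        using * by (induction ps) auto
      then show ?thesis using ps(2) comb_index[OF psc that] by simp
    qed
    then have "a = 0\<^sub>v (dim_col A)" using ps(2) comb_carrier[OF psc] by (intro eq_vecI) auto
    then show ?thesis by simp
  next
    case False
    then show ?thesis using comb_bound[OF ps(1) b] n0 ps(2) n_def by (intro disjI2 exI[of _ n]) auto
  qed
qed

section \<open>The program\<close>

text \<open>The array \<open>aG\<close> holds the rows of \<open>A\<close> and \<open>I\<close>, \<open>aZ\<close> the vector \<open>z\<close>; \<open>aM\<close> and \<open>aY\<close> are the copies
  transformed by the rounding step, which pivots on row \<open>vP\<close> after a move of length \<open>vT\<close>.  \<open>vN\<close> is the
  number \<open>n\<close> of summands still to be found and \<open>vL\<close> the multiplicity \<open>\<lambda>\<close>.\<close>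

abbreviation (input) "vC \<equiv> 2 :: nat"
abbreviation (input) "vD \<equiv> 3 :: nat"
abbreviation (input) "vR \<equiv> 4 :: nat"
abbreviation (input) "vN \<equiv> 5 :: nat"
abbreviation (input) "vT \<equiv> 6 :: nat"
abbreviation (input) "vP \<equiv> 7 :: nat"
abbreviation (input) "vS \<equiv> 8 :: nat"
abbreviation (input) "vU \<equiv> 9 :: nat"
abbreviation (input) "vQ \<equiv> 10 :: nat"
abbreviation (input) "vL \<equiv> 11 :: nat"
abbreviation (input) "vOk \<equiv> 12 :: nat"
abbreviation (input) "vNz \<equiv> 13 :: nat"
abbreviation (input) "vI \<equiv> 14 :: nat"
abbreviation (input) "vJ \<equiv> 15 :: nat"
abbreviation (input) "vK \<equiv> 16 :: nat"
abbreviation (input) "aG \<equiv> 20 :: nat"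
abbreviation (input) "aB \<equiv> 21 :: nat"
abbreviation (input) "aZ \<equiv> 22 :: nat"
abbreviation (input) "aM \<equiv> 23 :: nat"
abbreviation (input) "aY \<equiv> 24 :: nat"

abbreviation Assign :: "nat \<Rightarrow> aexp \<Rightarrow> com" where
  "Assign x f \<equiv> Store (Cell x (Const 0)) f"

abbreviation Seqs :: "com \<Rightarrow> com \<Rightarrow> com" (infixr \<open>;;\<close> 60) where
  "c ;; c' \<equiv> Seq c c'"

abbreviation Idx :: "aexp \<Rightarrow> aexp \<Rightarrow> aexp" where
  "Idx e f \<equiv> Add (Mul e (Var vD)) f"

definition read_array :: "nat \<Rightarrow> aexp \<Rightarrow> aexp \<Rightarrow> com" where
  "read_array k off e = For vI e (Read (Cell k (Add off (Var vI))))"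

definition mult_rows :: com where
  "mult_rows = For vI (Var vC)
     (Assign vS (Const 0) ;;
      For vJ (Var vD)
        (Assign vS (Add (Var vS) (Mul (Arr aG (Idx (Var vI) (Var vJ))) (Arr aZ (Add (Var vC) (Var vJ)))))) ;;
      Store (Cell aZ (Var vI)) (Var vS))"

text \<open>Unwritten cells hold 0, so only the diagonal of the identity block is stored. The vector
  a goes behind the first c cells of \<open>aZ\<close>, which \<open>mult_rows\<close> fills with A
  a.\<close>

definition read_input :: com where
  "read_input =
     Read (Cell vC (Const 0)) ;; Read (Cell vD (Const 0)) ;; Assign vR (Add (Var vC) (Var vD)) ;;
     read_array aG (Const 0) (Mul (Var vC) (Var vD)) ;;
     For vJ (Var vD) (Store (Cell aG (Idx (Add (Var vC) (Var vJ)) (Var vJ))) (Const 1)) ;;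
     read_array aB (Const 0) (Var vC) ;;
     read_array aZ (Var vC) (Var vD) ;;
     mult_rows"

text \<open>\<open>Div\<close> rounds down, so the two negations produce the ceiling of z / b. The
  result is the maximum of these ceilings and 1.\<close>

definition least_scale :: com where
  "least_scale =
     Assign vN (Const 1) ;;
     For vI (Var vC)
       (IfPos (Arr aB (Var vI))
         (Assign vQ (Sub (Const 0) (Div (Sub (Const 0) (Arr aZ (Var vI))) (Arr aB (Var vI)))) ;;
          IfPos (Sub (Var vQ) (Var vN)) (Assign vN (Var vQ)) Skip)
         Skip)"

definition check_scale :: com where
  "check_scale =
     Assign vOk (Const 1) ;;
     For vI (Var vC)
       (IfPos (Sub (Arr aZ (Var vI)) (Mul (Var vN) (Arr aB (Var vI)))) (Assign vOk (Const 0)) Skip)"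

text \<open>Branches only test for positivity, so squares serve as tests for being nonzero. For a =
  0 the earlier verdict is overruled and n = 0 keeps the main loop from running.\<close>

definition check_zero :: com where
  "check_zero =
     Assign vNz (Const 0) ;;
     For vI (Var vD)
       (IfPos (Mul (Arr aZ (Add (Var vC) (Var vI))) (Arr aZ (Add (Var vC) (Var vI))))
         (Assign vNz (Const 1)) Skip) ;;
     IfPos (Var vNz) Skip (Assign vN (Const 0) ;; Assign vOk (Const 1))"

definition copy_rows :: com where
  "copy_rows = For vI (Var vR)
     (Store (Cell aY (Var vI)) (Arr aZ (Var vI)) ;;
      For vJ (Var vD)
        (Store (Cell aM (Idx (Var vI) (Var vJ))) (Arr aG (Idx (Var vI) (Var vJ)))))"

text \<open>The start value n exceeds every residue modulo n, so the first row with a nonzero entry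
  replaces it. The second assignment to \<open>vU\<close> computes a residue by division.\<close>

definition choose_pivot :: com where
  "choose_pivot =
     Assign vT (Var vN) ;;
     For vI (Var vR)
       (Assign vS (Arr aM (Idx (Var vI) (Var vJ))) ;;
        IfPos (Mul (Var vS) (Var vS))
          (Assign vU (Sub (Const 0) (Mul (Var vS) (Arr aY (Var vI)))) ;;
           Assign vU (Sub (Var vU) (Mul (Var vN) (Div (Var vU) (Var vN)))) ;;
           IfPos (Sub (Var vT) (Var vU)) (Assign vT (Var vU) ;; Assign vP (Var vI)) Skip)
          Skip)"

definition move_point :: com where
  "move_point = For vI (Var vR)
     (Store (Cell aY (Var vI))
       (Add (Arr aY (Var vI)) (Mul (Var vT) (Arr aM (Idx (Var vI) (Var vJ))))))"

text \<open>The product is saved in \<open>vQ\<close> because the loop overwrites entry (p, k) when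
  it reaches row p.\<close>

definition eliminate_column :: com where
  "eliminate_column =
     Assign vQ (Mul (Arr aM (Idx (Var vP) (Var vK))) (Arr aM (Idx (Var vP) (Var vJ)))) ;;
     For vI (Var vR)
       (Store (Cell aM (Idx (Var vI) (Var vK)))
         (Sub (Arr aM (Idx (Var vI) (Var vK))) (Mul (Arr aM (Idx (Var vI) (Var vJ))) (Var vQ))))"

definition eliminate_columns :: com where
  "eliminate_columns = For vK (Var vD)
     (IfPos (Mul (Sub (Var vK) (Var vJ)) (Sub (Var vK) (Var vJ))) eliminate_column Skip)"

definition round_point :: com where
  "round_point = copy_rows ;; For vJ (Var vD) (choose_pivot ;; move_point ;; eliminate_columns)"

text \<open>Integral rows impose no restriction; if all rows are integral, the multiplicity stays at
  n and the decomposition ends.\<close>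

definition choose_coeff :: com where
  "choose_coeff =
     Assign vL (Var vN) ;;
     For vI (Var vR)
       (Assign vS (Sub (Arr aZ (Var vI)) (Mul (Var vN) (Div (Arr aZ (Var vI)) (Var vN)))) ;;
        IfPos (Var vS)
          (IfPos (Sub (Arr aY (Var vI)) (Arr aZ (Var vI))) Skip (Assign vS (Sub (Var vN) (Var vS))) ;;
           IfPos (Sub (Var vL) (Var vS)) (Assign vL (Var vS)) Skip)
          Skip)"

definition write_pair :: com where
  "write_pair = Write (Var vL) ;;
     For vI (Var vD) (Write (Div (Arr aY (Add (Var vC) (Var vI))) (Var vN)))"

definition subtract_pair :: com where
  "subtract_pair =
     For vI (Var vR)
       (Store (Cell aZ (Var vI))
         (Sub (Arr aZ (Var vI)) (Mul (Var vL) (Div (Arr aY (Var vI)) (Var vN))))) ;;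
     Assign vN (Sub (Var vN) (Var vL))"

definition decompose :: com where
  "decompose = WhilePos (Var vN) (round_point ;; choose_coeff ;; write_pair ;; subtract_pair)"

definition monoid_program :: com where
  "monoid_program =
     read_input ;; least_scale ;; check_scale ;; check_zero ;;
     IfPos (Var vOk) (Write (Const 1) ;; decompose) (Write (Const 0))"

section \<open>Specifications of the program blocks\<close>

abbreviation ent :: "memory \<Rightarrow> nat \<Rightarrow> nat \<Rightarrow> nat \<Rightarrow> nat \<Rightarrow> int" where
  "ent m k d i j \<equiv> arr m k (int i * int d + int j)"

abbreviation vals :: "memory \<Rightarrow> nat \<Rightarrow> nat \<Rightarrow> int" where
  "vals m k i \<equiv> arr m k (int i)"

lemma index_eq_iff:
  assumes "j < d" "j' < d"
  shows "int i * int d + int j = int i' * int d + int j' \<longleftrightarrow> i = i' \<and> j = j'"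
proof
  assume "int i * int d + int j = int i' * int d + int j'"
  then have "i * d + j = i' * d + j'" by (metis of_nat_add of_nat_eq_iff of_nat_mult)
  then have "(i * d + j) div d = (i' * d + j') div d" "(i * d + j) mod d = (i' * d + j') mod d"
    by simp_all
  then show "i = i' \<and> j = j'" using assms by simp
qed simp

lemma index_less:
  fixes i j c d :: nat
  assumes "i < c" "j < d" shows "i * d + j < c * d"
proof -
  have "i * d + j < Suc i * d" using assms by simp
  also have "\<dots> \<le> c * d" using assms by (intro mult_le_mono1) simp
  finally show ?thesis .
qed

lemmas wp_eval = aval_Arr arr_upd index_eq_iff

text \<open>The longest counted loop reads the c * d entries of the matrix; the decomposition loop
  runs at most c + d + 1 times.\<close>

locale program_bounds = resource_bounds +
  fixes c d :: nat
  assumes dims: "c * d + c + d + 1 \<le> N" "int N \<le> V"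
begin

lemma dim_bounds [simp]:
  "c \<le> N" "d \<le> N" "c + d \<le> N" "c * d \<le> N" "c + d + 1 \<le> N"
  "int c \<le> V" "int d \<le> V" "int c + int d \<le> V" "int c * int d \<le> V" "1 \<le> V" "0 \<le> V"
  using dims by (auto simp flip: of_nat_mult)

definition has_dims :: "memory \<Rightarrow> bool" where
  "has_dims m \<longleftrightarrow> var m vC = int c \<and> var m vD = int d \<and> var m vR = int c + int d"

lemma has_dims_frame: "frame X m m' \<Longrightarrow> {vC, vD, vR} \<inter> X = {} \<Longrightarrow> has_dims m \<Longrightarrow> has_dims m'"
  by (simp add: has_dims_def frameD)

lemmas wp_intros = wp_Seq wp_assign wp_IfPos wp_Skip wp_Write

lemma wp_read_array:
  assumes k: "k < 32" "k \<noteq> vI"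
    and off: "\<And>m'. frame {vI, k} m m' \<Longrightarrow> aval off m' = lo"
    and e: "\<And>m'. frame {vI, k} m m' \<Longrightarrow> aval e m' = int (length xs)"
    and xs: "length xs \<le> N" "\<And>x. x \<in> set xs \<Longrightarrow> \<bar>x\<bar> \<le> V"
    and Q: "\<And>m'. frame {vI, k} m m' \<Longrightarrow> bounded m' \<Longrightarrow>
      (\<And>i. arr m' k i = (if lo \<le> i \<and> i < lo + int (length xs) then xs ! nat (i - lo) else arr m k i)) \<Longrightarrow>
      Q (m', rest, out)"
  shows "wp (read_array k off e) Q (m, xs @ rest, out)"
  unfolding read_array_def
proof (rule wp_For[where X = "{k}" and n = "length xs" and I = "\<lambda>i m' inp' out'. inp' = drop i xs @ rest \<and>
    out' = out \<and> (\<forall>l. arr m' k l = (if lo \<le> l \<and> l < lo + int i then xs ! nat (l - lo) else arr m k l))"])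
  show "int (length xs) \<le> V" using xs(1) dims by linarith
  show "modifies {k} (Read (Cell k (Add off (Var vI))))" using k by (simp add: modifies_intros)
  fix i m' inp' out'
  assume i: "i < length xs" "var m' vI = int i" "frame {vI, k} m m'"
    "inp' = drop i xs @ rest \<and> out' = out \<and>
      (\<forall>l. arr m' k l = (if lo \<le> l \<and> l < lo + int i then xs ! nat (l - lo) else arr m k l))"
  have "drop i xs = xs ! i # drop (Suc i) xs" using i(1) by (simp add: Cons_nth_drop_Suc)
  then have inp: "inp' = xs ! i # drop (Suc i) xs @ rest" using i by simp
  show "wp (Read (Cell k (Add off (Var vI))))
      (\<lambda>(m'', inp'', out''). inp'' = drop (Suc i) xs @ rest \<and> out'' = out \<and>
        (\<forall>l. arr (upd m'' vI 0 (int (Suc i))) k l =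
          (if lo \<le> l \<and> l < lo + int (Suc i) then xs ! nat (l - lo) else arr m k l)))
      (m', inp', out')"
    unfolding inp using i off[OF i(3)] k xs(2)[of "xs ! i"]
    by (intro wp_read) (auto simp: wp_eval)
qed (use assms in \<open>auto simp: arr_upd\<close>)

text \<open>Every partial sum is stored in \<open>vS\<close>, so all prefixes of the scalar products
  must be bounded, not only their final values.\<close>

lemma wp_mult_rows:
  assumes m: "has_dims m"
    and z: "\<And>i j. i < c \<Longrightarrow> j \<le> d \<Longrightarrow> \<bar>\<Sum>l<j. ent m aG d i l * arr m aZ (int c + int l)\<bar> \<le> V"
    and Q: "\<And>m'. frame {vI, vJ, vS, aZ} m m' \<Longrightarrow> bounded m' \<Longrightarrow>
      (\<And>i. i < c \<Longrightarrow> vals m' aZ i = (\<Sum>l<d. ent m aG d i l * arr m aZ (int c + int l))) \<Longrightarrow>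
      (\<And>j. j < d \<Longrightarrow> arr m' aZ (int c + int j) = arr m aZ (int c + int j)) \<Longrightarrow> Q (m', inp, out)"
  shows "wp mult_rows Q (m, inp, out)"
  unfolding mult_rows_def
proof (rule wp_For[where X = "{vJ, vS, aZ}" and n = c and I = "\<lambda>i m' inp' out'. inp' = inp \<and> out' = out \<and>
    (\<forall>r<i. vals m' aZ r = (\<Sum>l<d. ent m aG d r l * arr m aZ (int c + int l))) \<and>
    (\<forall>j<d. arr m' aZ (int c + int j) = arr m aZ (int c + int j))"], goal_cases)
  case (8 i m1 inp1 out1)
  note fr = frameD[OF 8(4)]
  have m1: "has_dims m1" using m by (rule has_dims_frame[OF 8(4), rotated]) simp
  show ?case
  proof (rule wp_Seq, rule wp_assign, simp, rule wp_Seq,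
      rule wp_For[where X = "{vS}" and n = d and I = "\<lambda>j m' inp' out'. inp' = inp \<and> out' = out \<and>
      var m' vS = (\<Sum>l<j. ent m aG d i l * arr m aZ (int c + int l))"], goal_cases)
    case (8 j m2 inp2 out2)
    note fr2 = frameD[OF 8(4)]
    show ?case
      using 8 fr fr2 \<open>var m1 vI = int i\<close> \<open>i < c\<close> m1 z[of i "Suc j"] \<open>inp1 = _ \<and> _\<close>
      by (intro wp_assign) (auto simp: wp_eval has_dims_def)
  next
    case (9 m2 inp2 out2)
    note fr2 = frameD[OF 9(2)]
    show ?case
      using 9 fr fr2 \<open>var m1 vI = int i\<close> \<open>i < c\<close> z[of i d] \<open>inp1 = _ \<and> _\<close>
      by (intro wp_assign) (auto simp: wp_eval less_Suc_eq)
  qed (use 8 m1 in \<open>auto simp: modifies_intros wp_eval frameD has_dims_def\<close>)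
qed (use assms in \<open>auto simp: modifies_intros modifies_For wp_eval frameD has_dims_def\<close>)


lemma wp_read_input:
  assumes G: "length Gs = c * d" "\<And>x. x \<in> set Gs \<Longrightarrow> \<bar>x\<bar> \<le> V"
    and B: "length bs = c" "\<And>x. x \<in> set bs \<Longrightarrow> \<bar>x\<bar> \<le> V"
    and Z: "length as = d" "\<And>x. x \<in> set as \<Longrightarrow> \<bar>x\<bar> \<le> V"
    and sum: "\<And>i j. i < c \<Longrightarrow> j \<le> d \<Longrightarrow> \<bar>\<Sum>l<j. Gs ! (i * d + l) * as ! l\<bar> \<le> V"
    and Q: "\<And>m'. bounded m' \<Longrightarrow> has_dims m' \<Longrightarrow>
      (\<And>i j. i < c \<Longrightarrow> j < d \<Longrightarrow> ent m' aG d i j = Gs ! (i * d + j)) \<Longrightarrow>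
      (\<And>i j. i < d \<Longrightarrow> j < d \<Longrightarrow> ent m' aG d (c + i) j = (if i = j then 1 else 0)) \<Longrightarrow>
      (\<And>i. i < c \<Longrightarrow> vals m' aB i = bs ! i) \<Longrightarrow>
      (\<And>j. j < d \<Longrightarrow> arr m' aZ (int c + int j) = as ! j) \<Longrightarrow>
      (\<And>i. i < c \<Longrightarrow> vals m' aZ i = (\<Sum>l<d. Gs ! (i * d + l) * as ! l)) \<Longrightarrow> Q (m', rest, out)"
  shows "wp read_input Q (\<lambda>_. 0, int c # int d # Gs @ bs @ as @ rest, out)"
proof -
  have zero: "arr (\<lambda>_. 0) k i = 0" for k i by (simp add: arr_def)
  show ?thesis
    unfolding read_input_def
  proof (rule wp_Seq, rule wp_read, simp, rule wp_Seq, rule wp_read, simp, rule wp_Seq, rule wp_assign,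
      goal_cases)
    case 2
    define m0 where "m0 = upd (upd (upd (\<lambda>_. 0) vC 0 (int c)) vD 0 (int d)) vR 0 (int c + int d)"
    have m0: "has_dims m0" "arr m0 aG = (\<lambda>_. 0)"
      by (auto simp: m0_def has_dims_def wp_eval zero)
    have *: "wp (read_array aG (Const 0) (Mul (Var vC) (Var vD)) ;;
      For vJ (Var vD) (Store (Cell aG (Idx (Add (Var vC) (Var vJ)) (Var vJ))) (Const 1)) ;;
      read_array aB (Const 0) (Var vC) ;; read_array aZ (Var vC) (Var vD) ;; mult_rows) Q
      (m0, Gs @ bs @ as @ rest, out)"
    proof (rule wp_Seq, rule wp_read_array[where lo = 0], goal_cases)
      case (7 m1)
      note m1 = has_dims_frame[OF 7(1) _ m0(1)]
      have G1: "ent m1 aG d i j = Gs ! (i * d + j)" if "i < c" "j < d" for i j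
        using 7(3)[of "int i * int d + int j"] index_less[OF that] G(1)
        by (simp add: nat_add_distrib nat_mult_distrib zero_le_mult_iff flip: of_nat_mult of_nat_add)
      \<comment> \<open>The rows from c on lie beyond the c * d cells just filled and are still
        0.\<close>
      have G1': "ent m1 aG d (c + i) j = 0" for i j
      proof -
        have "int (c * d) \<le> int (c + i) * int d + int j"
          unfolding of_nat_mult[symmetric] of_nat_add[symmetric] of_nat_le_iff
          by (simp add: add_mult_distrib)
        then show ?thesis using 7(3)[of "int (c + i) * int d + int j"] G(1) m0(2) by simp
      qed
      show ?case
      proof (rule wp_Seq, rule wp_For[where X = "{aG}" and n = d and I = "\<lambda>j m' inp' out'.
          inp' = bs @ as @ rest \<and> out' = out \<and>
          (\<forall>i<c. \<forall>l<d. ent m' aG d i l = Gs ! (i * d + l)) \<and>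
          (\<forall>i<d. \<forall>l<d. ent m' aG d (c + i) l = (if i = l \<and> i < j then 1 else 0))"], goal_cases)
        case (8 j m2 inp2 out2)
        have "has_dims m2" using has_dims_frame[OF 8(4)] m1 by simp
        then have "arr m2 vC 0 * arr m2 vD 0 + arr m2 vJ 0 * arr m2 vD 0 + arr m2 vJ 0 =
            int (c + j) * int d + int j"
          using 8(3) by (simp add: has_dims_def algebra_simps)
        then have idx: "aval (Idx (Add (Var vC) (Var vJ)) (Var vJ)) m2 = int (c + j) * int d + int j"
          by (simp add: wp_eval algebra_simps)
        show ?case
          by (rule wp_assign, simp, unfold idx) (use 8 in \<open>auto simp: wp_eval simp del: of_nat_add\<close>)
      next
        case (9 m2 inp2 out2)
        then have inp2: "inp2 = bs @ as @ rest" "out2 = out" by auto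
        have m2: "has_dims m2" using has_dims_frame[OF 9(2)] m1 by simp
        show ?case
          unfolding inp2
        proof (rule wp_Seq, rule wp_read_array[where lo = 0], goal_cases)
          case (7 m3)
          note m3 = has_dims_frame[OF 7(1) _ m2]
          show ?case
          proof (rule wp_Seq, rule wp_read_array[where lo = "int c"], goal_cases)
            case (7 m4)
            note m4 = has_dims_frame[OF 7(1) _ m3]
            have G4: "arr m4 aG = arr m2 aG"
              using frameD[OF 7(1), of aG] frameD[OF \<open>frame _ m2 m3\<close>, of aG] by simp
            have a4: "arr m4 aZ (int c + int l) = as ! l" if "l < d" for l
              using 7(3) that Z(1) by simp
            have s4: "(\<Sum>l<j. ent m4 aG d i l * arr m4 aZ (int c + int l)) =
                (\<Sum>l<j. Gs ! (i * d + l) * as ! l)" if "i < c" "j \<le> d" for i j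
              using that 9(1) G4 a4 by (intro sum.cong) auto
            show ?case
            proof (rule wp_mult_rows, goal_cases)
              case (3 m5)
              note fr5 = frameD[OF 3(1)]
              show ?case
              proof (rule Q, goal_cases)
                case 2
                show ?case using has_dims_frame[OF 3(1)] m4 by simp
              next
                case (5 i)
                then show ?case
                  using fr5 frameD[OF 7(1), of aB] \<open>\<And>i. arr m3 aB i = _\<close> B(1) by simp
              qed (use 3 9(1) G4 fr5 a4 s4[OF _ order_refl] in \<open>simp_all del: of_nat_add\<close>)
            qed (use m4 s4 sum in \<open>simp_all del: of_nat_add\<close>)
          qed (use Z m3 in \<open>auto simp: wp_eval frameD has_dims_def\<close>)
        qed (use B m2 in \<open>auto simp: wp_eval frameD has_dims_def\<close>)
      qed (use G1 G1' m1 in \<open>auto simp: modifies_intros wp_eval frameD has_dims_def\<close>)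
    qed (use G m0 in \<open>auto simp: wp_eval frameD has_dims_def\<close>)
    show ?case using * by (simp add: m0_def wp_eval)
  qed (auto simp: wp_eval)
qed

text \<open>Together: the ceiling of z / b is the least n with z <= n b.\<close>

lemma ceiling_div:
  fixes z b n :: int
  assumes "0 < b"
  shows "z \<le> - (- z div b) * b" and "z \<le> n * b \<Longrightarrow> - (- z div b) \<le> n"
proof -
  have "- z = b * (- z div b) + (- z) mod b" "0 \<le> (- z) mod b"
    "- (- z div b) * b = - (b * (- z div b))"
    using assms by simp_all
  then show "z \<le> - (- z div b) * b" by linarith
  assume "z \<le> n * b"
  then have "(- n * b) div b \<le> - z div b" using assms by (intro zdiv_mono1) auto
  then have "- n \<le> - z div b" using assms by (subst (asm) nonzero_mult_div_cancel_right) auto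
  then show "- (- z div b) \<le> n" by simp
qed

text \<open>Feasibility is promised only for rows with a positive right-hand side, whereas
  minimality is against every n >= 1 that satisfies all rows.\<close>

lemma wp_least_scale:
  assumes m: "has_dims m" and F: "\<And>i. i < c \<Longrightarrow> \<bar>vals m aZ i\<bar> \<le> F" "1 \<le> F" "F \<le> V"
    and Q: "\<And>m'. frame {vI, vN, vQ} m m' \<Longrightarrow> bounded m' \<Longrightarrow> 1 \<le> var m' vN \<Longrightarrow> var m' vN \<le> F \<Longrightarrow>
      (\<And>i. i < c \<Longrightarrow> 0 < vals m aB i \<Longrightarrow> vals m aZ i \<le> var m' vN * vals m aB i) \<Longrightarrow>
      (\<And>n. 1 \<le> n \<Longrightarrow> \<forall>i<c. vals m aZ i \<le> n * vals m aB i \<Longrightarrow> var m' vN \<le> n) \<Longrightarrow> Q (m', inp, out)"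
  shows "wp least_scale Q (m, inp, out)"
  unfolding least_scale_def
proof (rule wp_Seq, rule wp_assign, simp, rule wp_For[where X = "{vN, vQ}" and n = c and
    I = "\<lambda>i m' inp' out'. inp' = inp \<and> out' = out \<and> 1 \<le> var m' vN \<and> var m' vN \<le> F \<and>
      (\<forall>r<i. 0 < vals m aB r \<longrightarrow> vals m aZ r \<le> var m' vN * vals m aB r) \<and>
      (\<forall>n\<ge>1. (\<forall>i<c. vals m aZ i \<le> n * vals m aB i) \<longrightarrow> var m' vN \<le> n)"], goal_cases)
  case (8 i m1 inp1 out1)
  let ?z = "vals m aZ i" and ?b = "vals m aB i"
  have fr: "arr m1 aZ = arr m aZ" "arr m1 aB = arr m aB"
    using 8(4) by (auto simp: frame_def arr_upd fun_eq_iff)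
  have q: "\<bar>- (- ?z div ?b)\<bar> \<le> F" using abs_div_le[of "- ?z" ?b] F(1)[OF 8(1)] by simp
  \<comment> \<open>Raising the scale keeps the rows with positive right-hand side that were already
    satisfied.\<close>
  have mono: "vals m aZ r \<le> n' * vals m aB r"
    if "0 < vals m aB r" "vals m aZ r \<le> n * vals m aB r" "n \<le> n'" for r n n'
    using that mult_right_mono[of n n' "vals m aB r"] by linarith
  show ?case
  proof (rule wp_IfPos, rule wp_Seq, rule wp_assign, goal_cases)
    case 2
    have pos: "0 < ?b" using 2 8(3) fr by (simp add: wp_eval)
    note cd = ceiling_div[OF pos, of ?z]
    show ?case
    proof (intro wp_IfPos wp_assign wp_Skip, goal_cases)
      case 2
      then have n: "var m1 vN < - (- ?z div ?b)" using 8(3) fr by (simp add: wp_eval)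
      have "vals m aZ r \<le> - (- ?z div ?b) * vals m aB r" if "r < Suc i" "0 < vals m aB r" for r
        using that cd(1) 8(2) mono[OF that(2) _ less_imp_le[OF n]] by (cases "r = i") auto
      moreover have "- (- ?z div ?b) \<le> n" if "\<forall>i<c. vals m aZ i \<le> n * vals m aB i" for n
        using that 8(1) cd(2) by blast
      ultimately show ?case using 8 fr q n by (auto simp: wp_eval)
    next
      case 3
      then have n: "- (- ?z div ?b) \<le> var m1 vN" using 8(3) fr by (simp add: wp_eval)
      have "vals m aZ r \<le> var m1 vN * vals m aB r" if "r < Suc i" "0 < vals m aB r" for r
        using that cd(1) 8(2) mono[OF that(2) _ n] by (cases "r = i") auto
      then show ?case using 8 by (auto simp: wp_eval)
    qed (use 8 fr q F in \<open>auto simp: wp_eval\<close>)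
  next
    case 3
    then have "\<not> 0 < ?b" using 8(3) fr by (simp add: wp_eval)
    then show ?case using 8 by (intro wp_Skip) (auto simp: wp_eval less_Suc_eq)
  qed (use 8 fr q F in \<open>auto simp: wp_eval\<close>)
next
  case (9 m' inp' out')
  have "frame {vI, vN, vQ} m m'"
    using 9(2) by (auto simp: frame_def arr_upd fun_eq_iff)
  with 9 show ?case using Q by blast
qed (use assms in \<open>auto simp: modifies_intros wp_eval frameD has_dims_def\<close>)

lemma wp_check_scale:
  assumes m: "has_dims m"
    and Q: "\<And>m'. frame {vI, vOk} m m' \<Longrightarrow> bounded m' \<Longrightarrow>
      (0 < var m' vOk \<longleftrightarrow> (\<forall>i<c. vals m aZ i \<le> var m vN * vals m aB i)) \<Longrightarrow> Q (m', inp, out)"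
  shows "wp check_scale Q (m, inp, out)"
  unfolding check_scale_def
proof (rule wp_Seq, rule wp_assign, simp, rule wp_For[where X = "{vOk}" and n = c and
    I = "\<lambda>i m' inp' out'. inp' = inp \<and> out' = out \<and>
      (0 < var m' vOk \<longleftrightarrow> (\<forall>r<i. vals m aZ r \<le> var m vN * vals m aB r))"], goal_cases)
  case (8 i m1 inp1 out1)
  have fr: "arr m1 aZ = arr m aZ" "arr m1 aB = arr m aB" "arr m1 vN = arr m vN"
    using 8(4) by (auto simp: frame_def arr_upd fun_eq_iff)
  show ?case
    by (intro wp_intros) (use 8(1-3) fr in \<open>auto simp: wp_eval less_Suc_eq\<close>)
next
  case (9 m' inp' out')
  have "frame {vI, vOk} m m'"
    using 9(2) by (auto simp: frame_def arr_upd fun_eq_iff)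
  with 9 show ?case using Q by blast
qed (use assms in \<open>auto simp: modifies_intros wp_eval frameD has_dims_def\<close>)

lemma wp_check_zero:
  assumes m: "has_dims m"
    and zero: "\<And>m'. \<forall>j<d. arr m aZ (int c + int j) = 0 \<Longrightarrow> frame {vI, vNz, vN, vOk} m m' \<Longrightarrow> bounded m' \<Longrightarrow>
      var m' vN = 0 \<Longrightarrow> var m' vOk = 1 \<Longrightarrow> Q (m', inp, out)"
    and nonzero: "\<And>m'. \<not> (\<forall>j<d. arr m aZ (int c + int j) = 0) \<Longrightarrow> frame {vI, vNz} m m' \<Longrightarrow> bounded m' \<Longrightarrow>
      Q (m', inp, out)"
  shows "wp check_zero Q (m, inp, out)"
  unfolding check_zero_def
proof (rule wp_Seq, rule wp_assign, simp, rule wp_Seq, rule wp_For[where X = "{vNz}" and n = d and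
    I = "\<lambda>i m' inp' out'. inp' = inp \<and> out' = out \<and>
      (0 < var m' vNz \<longleftrightarrow> \<not> (\<forall>j<i. arr m aZ (int c + int j) = 0))"], goal_cases)
  case (8 i m1 inp1 out1)
  have fr: "arr m1 aZ = arr m aZ" "var m1 vC = int c"
    using 8(4) m by (auto simp: frame_def arr_upd fun_eq_iff has_dims_def)
  show ?case
    by (intro wp_intros)
      (use 8(1-3) fr in \<open>auto simp: wp_eval less_Suc_eq not_less mult_le_0_iff zero_less_mult_iff\<close>)
next
  case (9 m' inp' out')
  have fr: "frame {vI, vNz} m m'"
    using 9(2) by (auto simp: frame_def arr_upd fun_eq_iff)
  have io: "inp' = inp" "out' = out" using 9(1) by auto
  show ?case
    unfolding io
  proof (rule wp_boundedI, rule wp_IfPos)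
    assume "0 < aval (Var vNz) (fst (m', inp, out))"
    then show "wp Skip Q (m', inp, out)"
      using 9(1,3) fr nonzero by (intro wp_Skip) (auto simp: wp_eval)
  next
    assume "\<not> 0 < aval (Var vNz) (fst (m', inp, out))"
    then have "\<forall>j<d. arr m aZ (int c + int j) = 0" using 9(1) by (simp add: wp_eval)
    then show "wp (Assign vN (Const 0) ;; Assign vOk (Const 1)) Q (m', inp, out)"
    proof (intro wp_Seq wp_assign zero)
      show "frame {vI, vNz, vN, vOk} m (upd (upd m' vN (aval (Const 0) m') (aval (Const 0) m')) vOk
          (aval (Const 0) (upd m' vN (aval (Const 0) m') (aval (Const 0) m')))
          (aval (Const 1) (upd m' vN (aval (Const 0) m') (aval (Const 0) m'))))"
        using fr by (auto simp: frame_def arr_upd fun_eq_iff)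
    qed (use 9(3) in \<open>auto simp: wp_eval bounded_cell\<close>)
  qed
qed (use assms in \<open>auto simp: modifies_intros wp_eval frameD has_dims_def\<close>)


lemma wp_copy_rows:
  assumes m: "has_dims m"
    and Q: "\<And>m'. frame {vI, vJ, aM, aY} m m' \<Longrightarrow> bounded m' \<Longrightarrow>
      (\<And>i. i < c + d \<Longrightarrow> vals m' aY i = vals m aZ i) \<Longrightarrow>
      (\<And>i j. i < c + d \<Longrightarrow> j < d \<Longrightarrow> ent m' aM d i j = ent m aG d i j) \<Longrightarrow> Q (m', inp, out)"
  shows "wp copy_rows Q (m, inp, out)"
  unfolding copy_rows_def
proof (rule wp_For[where X = "{vJ, aM, aY}" and n = "c + d" and I = "\<lambda>i m' inp' out'. inp' = inp \<and> out' = out \<and>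
    (\<forall>r<i. vals m' aY r = vals m aZ r) \<and> (\<forall>r<i. \<forall>l<d. ent m' aM d r l = ent m aG d r l)"], goal_cases)
  case (8 i m1 inp1 out1)
  have fr: "arr m1 aZ = arr m aZ" "arr m1 aG = arr m aG" "has_dims m1"
    using 8(4) m by (auto simp: frame_def has_dims_def)
  show ?case
  proof (rule wp_Seq, rule wp_assign, goal_cases)
    case 1
    show ?case using bounded_arr[OF 8(5)] by (simp add: wp_eval)
  next
    case 2
    show ?case
    proof (rule wp_For[where X = "{aM}" and n = d and I = "\<lambda>j m' inp' out'. inp' = inp \<and> out' = out \<and>
        (\<forall>l<j. ent m' aM d i l = ent m aG d i l) \<and> (\<forall>r<i. \<forall>l<d. ent m' aM d r l = ent m aG d r l)"],
        goal_cases)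
      case (8 j m2 inp2 out2)
      have fr2: "arr m2 aG = arr m aG" "var m2 vI = int i" "var m2 vD = int d"
        using 8(4) fr \<open>var m1 vI = int i\<close> by (auto simp: frame_def arr_upd has_dims_def)
      show ?case
        using 8(1-3) fr2 bounded_arr[OF 8(5), of aG]
        by (intro wp_assign) (auto simp: wp_eval less_Suc_eq)
    next
      case (9 m2 inp2 out2)
      have "arr m2 aY r = (if r = int i then vals m aZ i else arr m1 aY r)" for r
        using frameD[OF 9(2), of aY] \<open>var m1 vI = int i\<close> fr by (auto simp: wp_eval)
      then show ?case using 9(1) 8(2) by (auto simp: wp_eval less_Suc_eq)
    qed (use 8 fr in \<open>auto simp: modifies_intros wp_eval frameD has_dims_def\<close>)
  qed
next
  case (9 m1 inp1 out1)
  then show ?case using Q by auto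
qed (use assms in \<open>auto simp: modifies_intros modifies_For wp_eval frameD has_dims_def\<close>)

lemma wp_choose_pivot:
  assumes m: "has_dims m" and j: "j < d" "var m vJ = int j" and n: "0 < var m vN"
    and sign: "\<And>i. i < c + d \<Longrightarrow> ent m aM d i j \<in> {-1, 0, 1}" and nz: "\<exists>i<c + d. ent m aM d i j \<noteq> 0"
    and Q: "\<And>m' p. frame {vI, vS, vU, vT, vP} m m' \<Longrightarrow> bounded m' \<Longrightarrow> var m' vP = int p \<Longrightarrow>
      p < c + d \<Longrightarrow> ent m aM d p j \<noteq> 0 \<Longrightarrow>
      var m' vT = (- (ent m aM d p j * vals m aY p)) mod var m vN \<Longrightarrow>
      (\<And>i. i < c + d \<Longrightarrow> ent m aM d i j \<noteq> 0 \<Longrightarrow>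
        var m' vT \<le> (- (ent m aM d i j * vals m aY i)) mod var m vN) \<Longrightarrow> Q (m', inp, out)"
  shows "wp choose_pivot Q (m, inp, out)"
  unfolding choose_pivot_def
proof (rule wp_boundedI)
  assume bd: "bounded (fst (m, inp, out))"
  let ?n = "var m vN" and ?M = "\<lambda>i. ent m aM d i j" and ?y = "vals m aY"
  let ?u = "\<lambda>i. (- (?M i * ?y i)) mod ?n"
  show "wp (Assign vT (Var vN) ;; For vI (Var vR)
       (Assign vS (Arr aM (Idx (Var vI) (Var vJ))) ;;
        IfPos (Mul (Var vS) (Var vS))
          (Assign vU (Sub (Const 0) (Mul (Var vS) (Arr aY (Var vI)))) ;;
           Assign vU (Sub (Var vU) (Mul (Var vN) (Div (Var vU) (Var vN)))) ;;
           IfPos (Sub (Var vT) (Var vU)) (Assign vT (Var vU) ;; Assign vP (Var vI)) Skip)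
          Skip)) Q (m, inp, out)"
  proof (rule wp_Seq, rule wp_assign, goal_cases)
    case 1
    show ?case using bd bounded_arr by (simp add: wp_eval)
  next
    case 2
    show ?case
    proof (rule wp_For[where X = "{vS, vU, vT, vP}" and n = "c + d" and I = "\<lambda>i m' inp' out'. inp' = inp \<and> out' = out \<and>
        (\<forall>r<i. ?M r \<noteq> 0 \<longrightarrow> var m' vT \<le> ?u r) \<and>
        (var m' vT = ?n \<or> (\<exists>p<c + d. var m' vP = int p \<and> ?M p \<noteq> 0 \<and> var m' vT = ?u p))"], goal_cases)
      case (8 i m1 inp1 out1)
      have fr: "arr m1 aM = arr m aM" "arr m1 aY = arr m aY" "var m1 vN = ?n" "var m1 vJ = int j"
        "var m1 vD = int d"
        using 8(4) m j by (auto simp: frame_def has_dims_def arr_upd)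
      have y: "\<bar>?y i\<bar> \<le> V" "?n \<le> V"
        using bd bounded_arr[of m aY "int i"] bounded_arr[of m vN 0] by auto
      have s: "?M i \<in> {-1, 0, 1}" by (rule sign[OF 8(1)])
      \<comment> \<open>The sign entries keep this stored product within the bound on y.\<close>
      have My: "\<bar>?M i * ?y i\<bar> \<le> V" using s y by auto
      have u: "- (?M i * ?y i) - ?n * (- (?M i * ?y i) div ?n) = ?u i"
        by (rule minus_mult_div_eq_mod)
      have ub: "0 \<le> ?u i" "?u i < ?n" using n by simp_all
      show ?case
      proof (rule wp_Seq, rule wp_assign, goal_cases)
        case 1
        show ?case using s 8(3) fr by (auto simp: wp_eval)
      next
        case 2
        define m2 where "m2 = upd m1 vS 0 (?M i)"
        have upd: "upd m1 vS (aval (Const 0) m1) (aval (Arr aM (Idx (Var vI) (Var vJ))) m1) = m2"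
          using 8(3) fr by (simp add: m2_def wp_eval)
        show ?case
          unfolding upd
        proof (rule wp_IfPos, goal_cases)
          case 1
          then have nz: "?M i \<noteq> 0" by (auto simp: m2_def wp_eval)
          show ?case
          proof (rule wp_Seq, rule wp_assign, goal_cases)
            case 1
            show ?case using My 8(3) fr by (auto simp: m2_def wp_eval)
          next
            case 2
            define m3 where "m3 = upd m2 vU 0 (- (?M i * ?y i))"
            have upd3: "upd m2 vU (aval (Const 0) m2) (aval (Sub (Const 0) (Mul (Var vS) (Arr aY (Var vI)))) m2) = m3"
              using 8(3) fr by (simp add: m3_def m2_def wp_eval)
            show ?case
              unfolding upd3
            proof (rule wp_Seq, rule wp_assign, goal_cases)
              case 1
              show ?case using ub y u fr by (auto simp: m3_def m2_def wp_eval)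
            next
              case 2
              define m4 where "m4 = upd m3 vU 0 (?u i)"
              have upd4: "upd m3 vU (aval (Const 0) m3)
                  (aval (Sub (Var vU) (Mul (Var vN) (Div (Var vU) (Var vN)))) m3) = m4"
                using fr u by (simp add: m4_def m3_def m2_def wp_eval)
              have m4: "var m4 vU = ?u i" "var m4 vT = var m1 vT" "var m4 vI = int i" "var m4 vP = var m1 vP"
                using 8(3) by (auto simp: m4_def m3_def m2_def wp_eval)
              show ?case
                unfolding upd4
              proof (rule wp_IfPos, goal_cases)
                case 1
                then have less: "?u i < var m1 vT" using m4 by (simp add: wp_eval)
                then have "\<forall>r<i. ?M r \<noteq> 0 \<longrightarrow> ?u i \<le> ?u r" using 8(2) by auto
                with less show ?case
                  using 8(1,2) m4 nz ub y dim_bounds(8)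
                  by (intro wp_Seq wp_assign) (auto simp: wp_eval less_Suc_eq simp del: dim_bounds)
              next
                case 2
                then have "var m1 vT \<le> ?u i" using m4 by (simp add: wp_eval)
                then show ?case using 8(2) m4 by (intro wp_Skip) (auto simp: wp_eval less_Suc_eq)
              qed
            qed
          qed
        next
          case 2
          then have "?M i = 0" by (auto simp: m2_def wp_eval s zero_less_mult_iff)
          then show ?case using 8(2) by (intro wp_Skip) (auto simp: m2_def wp_eval less_Suc_eq)
        qed
      qed
    next
      case (9 m1 inp1 out1)
      have fr: "frame {vI, vS, vU, vT, vP} m m1" using 9(2) by (auto simp: frame_def arr_upd fun_eq_iff)
      have T: "var m1 vT \<le> ?u r" if "r < c + d" "?M r \<noteq> 0" for r using 9(1) that by blast
      obtain r where "r < c + d" "?M r \<noteq> 0" using nz by blast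
      \<comment> \<open>A nonzero entry exists, so the start value n is gone and \<open>vP\<close>
        holds a genuine pivot.\<close>
      then have "var m1 vT < ?n" using T[of r] n by (meson le_less_trans pos_mod_bound)
      then obtain p where p: "p < c + d" "var m1 vP = int p" "?M p \<noteq> 0" "var m1 vT = ?u p"
        using 9(1) by auto
      show ?case using Q[OF fr 9(3) p(2,1,3,4) T] 9(1) by simp
    qed (use m in \<open>auto simp: modifies_intros wp_eval frameD has_dims_def\<close>)
  qed
qed

lemma wp_move_point:
  assumes m: "has_dims m" and j: "j < d" "var m vJ = int j"
    and V: "\<And>i. i < c + d \<Longrightarrow> \<bar>vals m aY i + var m vT * ent m aM d i j\<bar> \<le> V"
    and Q: "\<And>m'. frame {vI, aY} m m' \<Longrightarrow> bounded m' \<Longrightarrow>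
      (\<And>i. i < c + d \<Longrightarrow> vals m' aY i = vals m aY i + var m vT * ent m aM d i j) \<Longrightarrow> Q (m', inp, out)"
  shows "wp move_point Q (m, inp, out)"
  unfolding move_point_def
proof (rule wp_For[where X = "{aY}" and n = "c + d" and I = "\<lambda>i m' inp' out'. inp' = inp \<and> out' = out \<and>
    (\<forall>r. vals m' aY r = (if r < i then vals m aY r + var m vT * ent m aM d r j else vals m aY r))"], goal_cases)
  case (8 i m1 inp1 out1)
  have fr: "arr m1 aM = arr m aM" "arr m1 vT = arr m vT" "var m1 vJ = int j" "var m1 vD = int d"
    using 8(4) m j by (auto simp: frame_def has_dims_def)
  show ?case
    using 8(1-3) fr V[OF 8(1)] by (intro wp_assign) (auto simp: wp_eval)
next
  case (9 m1 inp1 out1)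
  then show ?case using Q by auto
qed (use m in \<open>auto simp: modifies_intros wp_eval frameD has_dims_def\<close>)

lemma wp_eliminate_column:
  assumes m: "has_dims m" and j: "j < d" "var m vJ = int j" and p: "var m vP = int p" "p < c + d"
    and k: "k < d" "var m vK = int k" "k \<noteq> j"
    and sign: "\<bar>ent m aM d p k * ent m aM d p j\<bar> \<le> V"
    and V: "\<And>i. i < c + d \<Longrightarrow> \<bar>eliminate p j (ent m aM d) i k\<bar> \<le> V"
    and Q: "\<And>m'. frame {vI, vQ, aM} m m' \<Longrightarrow> bounded m' \<Longrightarrow>
      (\<And>i l. i < c + d \<Longrightarrow> l < d \<Longrightarrow>
        ent m' aM d i l = (if l = k then eliminate p j (ent m aM d) i l else ent m aM d i l)) \<Longrightarrow> Q (m', inp, out)"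
  shows "wp eliminate_column Q (m, inp, out)"
  unfolding eliminate_column_def
proof (rule wp_Seq, rule wp_assign, goal_cases)
  case 1
  show ?case using m j p k sign by (auto simp: wp_eval has_dims_def)
next
  case 2
  show ?case
  proof (rule wp_For[where X = "{aM}" and n = "c + d" and I = "\<lambda>i m' inp' out'. inp' = inp \<and> out' = out \<and>
      (\<forall>r l. l < d \<longrightarrow>
        ent m' aM d r l = (if l = k \<and> r < i then eliminate p j (ent m aM d) r l else ent m aM d r l))"], goal_cases)
    case (8 i m1 inp1 out1)
    have fr: "var m1 vQ = ent m aM d p k * ent m aM d p j" "var m1 vJ = int j" "var m1 vK = int k" "var m1 vD = int d"
      using 8(4) m j k p by (auto simp: frame_def has_dims_def wp_eval)
    show ?case
      using 8(1-3) fr j k V[OF 8(1)] by (intro wp_assign) (auto simp: wp_eval eliminate_def)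
  next
    case (9 m1 inp1 out1)
    have "frame {vI, vQ, aM} m m1" using 9(2) by (auto simp: frame_def arr_upd fun_eq_iff)
    with 9 show ?case using Q by auto
  qed (use m in \<open>auto simp: modifies_intros wp_eval frameD has_dims_def\<close>)
qed

lemma wp_eliminate_columns:
  assumes m: "has_dims m" and j: "j < d" "var m vJ = int j" and p: "var m vP = int p" "p < c + d"
    and sign: "\<And>k. k < d \<Longrightarrow> \<bar>ent m aM d p k * ent m aM d p j\<bar> \<le> V"
    and V: "\<And>i k. i < c + d \<Longrightarrow> k < d \<Longrightarrow> \<bar>eliminate p j (ent m aM d) i k\<bar> \<le> V"
    and Q: "\<And>m'. frame {vI, vK, vQ, aM} m m' \<Longrightarrow> bounded m' \<Longrightarrow>
      (\<And>i k. i < c + d \<Longrightarrow> k < d \<Longrightarrow> ent m' aM d i k = eliminate p j (ent m aM d) i k) \<Longrightarrow> Q (m', inp, out)"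
  shows "wp eliminate_columns Q (m, inp, out)"
  unfolding eliminate_columns_def
proof (rule wp_For[where X = "{vI, vQ, aM}" and n = d and I = "\<lambda>k m' inp' out'. inp' = inp \<and> out' = out \<and>
    (\<forall>i<c + d. \<forall>l<d. ent m' aM d i l = (if l < k then eliminate p j (ent m aM d) i l else ent m aM d i l))"],
    goal_cases)
  case (8 k m1 inp1 out1)
  have fr: "has_dims m1" "var m1 vJ = int j" "var m1 vP = int p"
    using 8(4) m j p by (auto simp: frame_def has_dims_def)
  have io: "inp1 = inp" "out1 = out" using 8(2) by auto
  have M1: "ent m1 aM d i l = (if l < k then eliminate p j (ent m aM d) i l else ent m aM d i l)"
    if "i < c + d" "l < d" for i l using 8(2) that by blast
  have same: "ent m1 aM d i j = ent m aM d i j" if "i < c + d" for i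
    using M1[OF that j(1)] by (simp add: eliminate_def)
  show ?case
    unfolding io
  proof (rule wp_IfPos, goal_cases)
    case 1
    then have "k \<noteq> j" using 8(3) fr by (auto simp: wp_eval)
    \<comment> \<open>Column k is still untouched and column j never changes, so working in place
      gives the same result as working on the original matrix.\<close>
    have el: "eliminate p j (ent m1 aM d) i k = eliminate p j (ent m aM d) i k" if "i < c + d" for i
      using M1[OF that 8(1)] M1[OF p(2) 8(1)] same[OF that] same[OF p(2)] by (simp add: eliminate_def)
    show ?case
    proof (rule wp_eliminate_column[where j = j and p = p and k = k], goal_cases)
      case (11 m2)
      show ?case using 11(3) M1 el by (auto simp: wp_eval less_Suc_eq)
    qed (use fr j p 8 \<open>k \<noteq> j\<close> el V sign[OF 8(1)] M1[OF p(2) 8(1)] same[OF p(2)] in auto)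
  next
    case 2
    then have "k = j" using 8(3) fr by (auto simp: wp_eval zero_less_mult_iff not_less)
    then show ?case using M1 same by (intro wp_Skip) (auto simp: wp_eval less_Suc_eq eliminate_def)
  qed
next
  case (9 m1 inp1 out1)
  have "frame {vI, vK, vQ, aM} m m1" using 9(2) by (auto simp: frame_def)
  with 9 show ?case using Q by auto
qed (use m in \<open>auto simp: modifies_intros modifies_For eliminate_column_def wp_eval frameD has_dims_def\<close>)

lemma wp_round_point:
  assumes m: "has_dims m" and n: "0 < var m vN"
    and minors: "\<And>f. (\<And>k. k < d \<Longrightarrow> f k < c + d) \<Longrightarrow> minor G d f id \<in> {-1, 0, 1}"
    and unit: "\<And>k l. k < d \<Longrightarrow> l < d \<Longrightarrow> G (c + k) l = (if l = k then 1 else 0)"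
    and G: "\<And>i k. i < c + d \<Longrightarrow> k < d \<Longrightarrow> ent m aG d i k = G i k"
    and z: "\<And>i. i < c + d \<Longrightarrow> vals m aZ i = (\<Sum>k<d. G i k * w k)"
    and V: "\<And>i. i < c + d \<Longrightarrow> \<bar>var m vN * (vals m aZ i div var m vN)\<bar> \<le> V"
      "\<And>i. i < c + d \<Longrightarrow> \<bar>var m vN * - (- vals m aZ i div var m vN)\<bar> \<le> V"
    and Q: "\<And>m'. frame {vI, vJ, vK, vS, vT, vU, vP, vQ, aM, aY} m m' \<Longrightarrow> bounded m' \<Longrightarrow>
      round_inv (c + d) d (var m vN) G (vals m aZ) d (ent m' aM d) (vals m' aY) \<Longrightarrow> Q (m', inp, out)"
  shows "wp round_point Q (m, inp, out)"
  unfolding round_point_def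
proof (rule wp_Seq, rule wp_copy_rows[OF m])
  let ?inv = "\<lambda>j m'. round_inv (c + d) d (var m vN) G (vals m aZ) j (ent m' aM d) (vals m' aY)"
  let ?X = "{vI, vK, vS, vT, vU, vP, vQ, aM, aY}"
  \<comment> \<open>All values of y stay between the multiples of n enclosing z, so two bounds per
    row cover the whole rounding.\<close>
  have vals_V: "\<bar>y i\<bar> \<le> V" if "round_inv (c + d) d (var m vN) G (vals m aZ) j M y" "i < c + d" for j M y i
    using round_inv_bounds[OF that] V[OF that(2)] by linarith
  have ent_V: "\<bar>M i k\<bar> \<le> V" if "round_inv (c + d) d (var m vN) G (vals m aZ) j M y" "i < c + d" "k < d" for j M y i k
    using round_inv_entry[OF that] dim_bounds(10,11) by auto
  fix m1
  assume m1: "frame {vI, vJ, aM, aY} m m1" "bounded m1"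
    "\<And>i. i < c + d \<Longrightarrow> vals m1 aY i = vals m aZ i"
    "\<And>i j. i < c + d \<Longrightarrow> j < d \<Longrightarrow> ent m1 aM d i j = ent m aG d i j"
  show "wp (For vJ (Var vD) (choose_pivot ;; move_point ;; eliminate_columns)) Q (m1, inp, out)"
  proof (rule wp_For[where X = ?X and n = d and I = "\<lambda>j m' inp' out'. inp' = inp \<and> out' = out \<and> ?inv j m'"], goal_cases)
    case 7
    have "?inv 0 m1"
      using minors z unit n m1(3,4) G by (intro round_inv_init[where R = "\<lambda>k. c + k"]) auto
    then show ?case by (simp add: arr_upd)
  next
    case (8 j m2 inp2 out2)
    have fr: "frame {vI, vJ, vK, vS, vT, vU, vP, vQ, aM, aY} m m2"
      using m1(1) 8(4) by (auto simp: frame_def)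
    have m2: "has_dims m2" using has_dims_frame[OF fr _ m] by simp
    have n2: "var m2 vN = var m vN" using frameD[OF fr] by simp
    have inv: "?inv j m2" and io: "inp2 = inp" "out2 = out" using 8(2) by auto
    show ?case
      unfolding io
    proof (rule wp_Seq, rule wp_choose_pivot[OF m2 8(1,3)], goal_cases)
      case 1
      show ?case using n n2 by simp
    next
      case (2 i)
      then show ?case using round_inv_entry[OF inv] 8(1) by blast
    next
      case 3
      show ?case using round_inv_column[OF inv 8(1)] .
    next
      case (4 m3 p)
      define y' where "y' i = vals m2 aY i + var m3 vT * ent m2 aM d i j" for i
      have step: "round_inv (c + d) d (var m vN) G (vals m aZ) (Suc j) M' y''"
        if "\<And>i. i < c + d \<Longrightarrow> y'' i = y' i"
          "\<And>i k. i < c + d \<Longrightarrow> k < d \<Longrightarrow> M' i k = eliminate p j (ent m2 aM d) i k" for M' y''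
        using round_inv_step[OF inv n 8(1) 4(4,5,6)[unfolded n2] 4(7)[unfolded n2]] that
        unfolding y'_def by blast
      have fr3: "arr m3 aM = arr m2 aM" "arr m3 aY = arr m2 aY" "var m3 vJ = int j"
        using frameD[OF 4(1)] 8(3) by auto
      have m3: "has_dims m3" using has_dims_frame[OF 4(1) _ m2] by simp
      \<comment> \<open>Applied to the intended results before they are computed: the next invariant
        supplies the bounds on the values about to be stored.\<close>
      note inv' = step[of y' "eliminate p j (ent m2 aM d)", OF refl refl]
      show ?case
      proof (rule wp_Seq, rule wp_move_point[OF m3 8(1) fr3(3)], goal_cases)
        case (1 i)
        then show ?case using vals_V[OF inv'] fr3 by (simp add: y'_def)
      next
        case (2 m4)
        have fr4: "arr m4 aM = arr m2 aM" "var m4 vJ = int j" "var m4 vP = int p"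
          using frameD[OF 2(1)] fr3 4(3) by auto
        have m4: "has_dims m4" using has_dims_frame[OF 2(1) _ m3] by simp
        show ?case
        proof (rule wp_eliminate_columns[OF m4 8(1) fr4(2,3) 4(4)], goal_cases)
          case (1 k)
          have "ent m2 aM d p k \<in> {-1, 0, 1}" "ent m2 aM d p j \<in> {-1, 0, 1}"
            using round_inv_entry[OF inv 4(4)] 1 8(1) by blast+
          then show ?case using fr4(1) dim_bounds(10,11) by auto
        next
          case (2 i k)
          then show ?case using ent_V[OF inv'] fr4(1) by simp
        next
          case (3 m5)
          have "arr m5 aY = arr m4 aY" using frameD[OF 3(1)] by simp
          then show ?case
            using step[of "vals m5 aY" "ent m5 aM d"] 3(3) 2(3) fr3 fr4 by (simp add: y'_def arr_upd)
        qed
      qed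
    qed
  next
    case (9 m2 inp2 out2)
    have "frame {vI, vJ, vK, vS, vT, vU, vP, vQ, aM, aY} m m2"
      using m1(1) 9(2) by (auto simp: frame_def)
    with 9 show ?case using Q by blast
  next
    case 3
    show ?case
      by (auto simp: modifies_intros modifies_For choose_pivot_def move_point_def eliminate_columns_def
        eliminate_column_def)
  next
    case (4 m')
    then show ?case using m m1(1) by (auto simp: wp_eval frameD has_dims_def)
  qed (use m in \<open>auto\<close>)
qed

lemma wp_choose_coeff:
  assumes m: "has_dims m" and n: "0 < var m vN"
    and Q: "\<And>m'. frame {vI, vS, vL} m m' \<Longrightarrow> bounded m' \<Longrightarrow> 0 < var m' vL \<Longrightarrow> var m' vL \<le> var m vN \<Longrightarrow>
      (\<And>i. i \<in> fractional_rows (c + d) (var m vN) (vals m aZ) \<Longrightarrow>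
        var m' vL \<le> (if vals m aZ i < vals m aY i then vals m aZ i mod var m vN
          else var m vN - vals m aZ i mod var m vN)) \<Longrightarrow>
      var m' vL = var m vN \<or> (\<exists>i\<in>fractional_rows (c + d) (var m vN) (vals m aZ).
        var m' vL = (if vals m aZ i < vals m aY i then vals m aZ i mod var m vN
          else var m vN - vals m aZ i mod var m vN)) \<Longrightarrow> Q (m', inp, out)"
  shows "wp choose_coeff Q (m, inp, out)"
  unfolding choose_coeff_def
proof (rule wp_boundedI, rule wp_Seq, rule wp_assign, goal_cases)
  case 1
  then show ?case using bounded_arr by (simp add: wp_eval)
next
  case 2
  let ?n = "var m vN" and ?z = "vals m aZ" and ?y = "vals m aY"
  let ?F = "fractional_rows (c + d) ?n ?z"
  let ?u = "\<lambda>i. if ?z i < ?y i then ?z i mod ?n else ?n - ?z i mod ?n"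
  have nV: "?n \<le> V" using 2 bounded_arr[of m vN 0] by simp
  show ?case
  proof (rule wp_For[where X = "{vS, vL}" and n = "c + d" and I = "\<lambda>i m' inp' out'. inp' = inp \<and> out' = out \<and>
      0 < var m' vL \<and> var m' vL \<le> ?n \<and> (\<forall>r<i. r \<in> ?F \<longrightarrow> var m' vL \<le> ?u r) \<and>
      (var m' vL = ?n \<or> (\<exists>i\<in>?F. var m' vL = ?u i))"], goal_cases)
    case (8 i m1 inp1 out1)
    have fr: "arr m1 aZ = arr m aZ" "arr m1 aY = arr m aY" "var m1 vN = ?n"
      using 8(4) by (auto simp: frame_def arr_upd)
    have r: "?z i - ?n * (?z i div ?n) = ?z i mod ?n" by (rule minus_mult_div_eq_mod)
    have rb: "0 \<le> ?z i mod ?n" "?z i mod ?n < ?n" using n by simp_all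
    have frac: "i \<in> ?F \<longleftrightarrow> 0 < ?z i mod ?n"
      using 8(1) rb(1) by (auto simp: fractional_rows_def dvd_eq_mod_eq_0)
    define m2 where "m2 = upd m1 vS 0 (?z i mod ?n)"
    have upd: "upd m1 vS (aval (Const 0) m1)
        (aval (Sub (Arr aZ (Var vI)) (Mul (Var vN) (Div (Arr aZ (Var vI)) (Var vN)))) m1) = m2"
      using fr 8(3) r by (simp add: m2_def wp_eval)
    show ?case
    proof (rule wp_Seq, rule wp_assign, goal_cases)
      case 1
      show ?case using fr 8(3) r rb nV by (simp add: wp_eval)
    next
      case 2
      show ?case
        unfolding upd
      proof (rule wp_IfPos, goal_cases)
        case 1
        then have i: "i \<in> ?F" using frac by (simp add: m2_def wp_eval)
        have u: "0 < ?u i" "?u i \<le> ?n" using i frac rb by auto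
        \<comment> \<open>The final comparison is shared by both ways of obtaining the limit in
          \<open>vS\<close>.\<close>
        have *: "wp (IfPos (Sub (Var vL) (Var vS)) (Assign vL (Var vS)) Skip)
            (\<lambda>(m'', inp'', out''). inp'' = inp \<and> out'' = out \<and>
              0 < var (upd m'' vI 0 (int (Suc i))) vL \<and> var (upd m'' vI 0 (int (Suc i))) vL \<le> ?n \<and>
              (\<forall>r<Suc i. r \<in> ?F \<longrightarrow> var (upd m'' vI 0 (int (Suc i))) vL \<le> ?u r) \<and>
              (var (upd m'' vI 0 (int (Suc i))) vL = ?n \<or>
                (\<exists>r\<in>?F. var (upd m'' vI 0 (int (Suc i))) vL = ?u r))) (m3, inp1, out1)"
          if m3: "var m3 vS = ?u i" "var m3 vL = var m1 vL" for m3
        proof (rule wp_IfPos, goal_cases)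
          case 1
          then have less: "?u i < var m1 vL" using m3 by (simp add: wp_eval)
          have "\<forall>r<Suc i. r \<in> ?F \<longrightarrow> ?u i \<le> ?u r"
          proof (intro allI impI)
            fix r assume r: "r < Suc i" "r \<in> ?F"
            show "?u i \<le> ?u r"
            proof (cases "r = i")
              case False
              then have "var m1 vL \<le> ?u r" using 8(2) r by (metis less_Suc_eq)
              with less show ?thesis by linarith
            qed simp
          qed
          then show ?case
            using i u m3 nV 8(2) by (intro wp_assign) (simp_all add: wp_eval del: if_split, blast)
        next
          case 2
          then have ge: "var m1 vL \<le> ?u i" using m3 by (simp add: wp_eval)
          have "\<forall>r<Suc i. r \<in> ?F \<longrightarrow> var m1 vL \<le> ?u r"
            using 8(2) ge by (metis less_Suc_eq)
          then show ?case using m3 8(2) by (intro wp_Skip) (simp add: wp_eval)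
        qed
        show ?case
        proof (rule wp_Seq, rule wp_IfPos, goal_cases)
          case 1
          then have "?z i < ?y i" using 8(3) fr by (simp add: m2_def wp_eval)
          then show ?case by (intro wp_Skip *) (auto simp: m2_def wp_eval)
        next
          case 2
          then have "\<not> ?z i < ?y i" using 8(3) fr by (simp add: m2_def wp_eval)
          then show ?case
            using rb nV fr by (intro wp_assign *) (auto simp: m2_def wp_eval)
        qed
      next
        case 2
        then have i: "i \<notin> ?F" using frac by (simp add: m2_def wp_eval)
        have "\<forall>r<Suc i. r \<in> ?F \<longrightarrow> var m1 vL \<le> ?u r"
          using 8(2) i by (metis less_Suc_eq)
        then show ?case using 8(2) by (intro wp_Skip) (simp add: m2_def wp_eval)
      qed
    qed
  next
    case (9 m1 inp1 out1)
    have fr: "frame {vI, vS, vL} m m1" using 9(2) by (auto simp: frame_def arr_upd fun_eq_iff)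
    have "\<And>i. i \<in> ?F \<Longrightarrow> i < c + d" by (simp add: fractional_rows_def)
    then show ?case using Q[OF fr 9(3)] 9(1) by blast
  qed (use m n in \<open>auto simp: modifies_intros wp_eval frameD has_dims_def\<close>)
qed

lemma wp_write_pair:
  assumes m: "has_dims m"
    and Q: "\<And>m'. frame {vI} m m' \<Longrightarrow> bounded m' \<Longrightarrow>
      Q (m', inp, out @ var m vL # map (\<lambda>k. arr m aY (int c + int k) div var m vN) [0..<d])"
  shows "wp write_pair Q (m, inp, out)"
  unfolding write_pair_def
proof (rule wp_Seq, rule wp_Write, rule wp_For[where X = "{}" and n = d and I = "\<lambda>i m' inp' out'. inp' = inp \<and>
    out' = out @ var m vL # map (\<lambda>k. arr m aY (int c + int k) div var m vN) [0..<i]"], goal_cases)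
  case (8 i m1 inp1 out1)
  have fr: "arr m1 aY = arr m aY" "var m1 vN = var m vN" "var m1 vC = int c"
    using 8(4) m by (auto simp: frame_def has_dims_def)
  show ?case using 8(2,3) fr by (intro wp_Write) (auto simp: wp_eval)
next
  case (9 m1 inp1 out1)
  then show ?case using Q by auto
qed (use m in \<open>auto simp: modifies_intros wp_eval frameD has_dims_def\<close>)

lemma wp_subtract_pair:
  assumes m: "has_dims m"
    and V: "\<And>i. i < c + d \<Longrightarrow> \<bar>vals m aZ i - var m vL * (vals m aY i div var m vN)\<bar> \<le> V"
      "\<bar>var m vN - var m vL\<bar> \<le> V"
    and Q: "\<And>m'. frame {vI, vN, aZ} m m' \<Longrightarrow> bounded m' \<Longrightarrow> var m' vN = var m vN - var m vL \<Longrightarrow>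
      (\<And>i. i < c + d \<Longrightarrow> vals m' aZ i = vals m aZ i - var m vL * (vals m aY i div var m vN)) \<Longrightarrow> Q (m', inp, out)"
  shows "wp subtract_pair Q (m, inp, out)"
  unfolding subtract_pair_def
proof (rule wp_Seq, rule wp_For[where X = "{aZ}" and n = "c + d" and I = "\<lambda>i m' inp' out'. inp' = inp \<and> out' = out \<and>
    (\<forall>r. vals m' aZ r = (if r < i then vals m aZ r - var m vL * (vals m aY r div var m vN) else vals m aZ r))"],
    goal_cases)
  case (8 i m1 inp1 out1)
  have fr: "arr m1 aY = arr m aY" "var m1 vN = var m vN" "var m1 vL = var m vL"
    using 8(4) by (auto simp: frame_def)
  show ?case
    using 8(1-3) fr V(1)[OF 8(1)] by (intro wp_assign) (auto simp: wp_eval)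
next
  case (9 m1 inp1 out1)
  have fr: "var m1 vN = var m vN" "var m1 vL = var m vL"
    using 9(2) by (auto simp: frame_def)
  have io: "inp1 = inp" "out1 = out" using 9(1) by auto
  show ?case
    unfolding io
  proof (rule wp_boundedI, rule wp_assign, goal_cases)
    case 1
    show ?case using V(2) fr by (simp add: wp_eval)
  next
    case 2
    show ?case
    proof (rule Q, goal_cases)
      case 1
      show ?case using 9(2) by (auto simp: frame_def arr_upd fun_eq_iff)
    next
      case 2
      show ?case using 9(3) V(2) fr by (intro bounded_cell) (auto simp: wp_eval)
    qed (use 9(1) fr in \<open>auto simp: wp_eval\<close>)
  qed
qed (use m in \<open>auto simp: modifies_intros wp_eval frameD has_dims_def\<close>)

end

section \<open>Correctness of the program\<close>

lemma encode_pairs_append: "encode_pairs (ps @ qs) = encode_pairs ps @ encode_pairs qs"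
  by (simp add: encode_pairs_def)

lemma concat_mat_to_list:
  "concat (mat_to_list A) = map (\<lambda>k. A $$ (k div dim_col A, k mod dim_col A)) [0..<dim_row A * dim_col A]"
proof -
  have "concat (map (\<lambda>i. map (\<lambda>j. f i j) [0..<d]) [0..<c]) = map (\<lambda>k. f (k div d) (k mod d)) [0..<c * d]"
    for f :: "nat \<Rightarrow> nat \<Rightarrow> 'a" and c d
  proof (induction c)
    case (Suc c)
    have "[0..<Suc c * d] = [0..<c * d] @ map (\<lambda>j. j + c * d) [0..<d]"
      using upt_add_eq_append[of 0 "c * d" d] by (simp add: map_add_upt add.commute)
    with Suc show ?case by simp
  qed simp
  then show ?thesis by (simp add: mat_to_list_def)
qed

text \<open>F is an integer, so rounding z / n down cannot leave the interval from -F to F. Applied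
  to -z, it bounds the ceiling.\<close>

lemma abs_div_bound:
  fixes n z F :: int
  assumes "0 < n" "\<bar>z\<bar> \<le> n * F"
  shows "\<bar>n * (z div n)\<bar> \<le> n * F"
proof -
  have "z \<le> F * n" "- F * n \<le> z" using assms by (auto simp: mult.commute[of n] abs_le_iff)
  then have "z div n \<le> (F * n) div n" "(- F * n) div n \<le> z div n"
    using assms(1) by (intro zdiv_mono1; simp)+
  moreover have "x * n div n = x" for x using assms(1) by simp
  ultimately have "\<bar>z div n\<bar> \<le> F" by (metis abs_leI minus_le_iff)
  then show ?thesis using assms(1) by (simp add: abs_mult)
qed

section \<open>The main loop and the whole program\<close>

locale decomposition_bounds = program_bounds +
  fixes A :: "int mat" and b a :: "int vec" and F :: int
  assumes A: "A \<in> carrier_mat c d" and TU: "totally_unimodular A"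
    and b: "b \<in> carrier_vec c" and a: "a \<in> carrier_vec d"
    and F: "1 \<le> F" "F * F \<le> V"
begin

lemma dims_A [simp]: "dim_row A = c" "dim_col A = d"
  using A by auto

text \<open>\<open>F\<close> bounds the scale n, and \<open>n * F\<close> bounds the rows, whence
  \<open>F * F \<le> V\<close>. The summand 1 in the variant pays for the last round, where l = n
  and no row has to become integral.\<close>

definition loop_inv :: "nat \<Rightarrow> config \<Rightarrow> bool" where
  "loop_inv k = (\<lambda>(m, inp, out). has_dims m \<and> var m vN \<le> F \<and>
    (\<forall>i<c + d. \<forall>j<d. ent m aG d i j = append_id A i j) \<and>
    dec_inv A b F (var m vN) (vals m aZ) \<and>
    (\<exists>ps. snd ` set ps \<subseteq> integer_points A b \<and> out = 1 # encode_pairs ps \<and>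
      (\<forall>k<d. a $ k = comb d ps $ k + vals m aZ (c + k))) \<and>
    k = (if var m vN = 0 then 0 else 1 + card (fractional_rows (c + d) (var m vN) (vals m aZ))))"

lemma wp_decompose_body:
  assumes inv: "loop_inv k (m, inp, out)" and n: "0 < var m vN"
  shows "wp (round_point ;; choose_coeff ;; write_pair ;; subtract_pair)
    (\<lambda>s'. \<exists>k'<k. loop_inv k' s') (m, inp, out)"
proof -
  let ?n = "var m vN" and ?z = "vals m aZ"
  have m: "has_dims m" and nF: "?n \<le> F"
    and G: "\<And>i j. i < c + d \<Longrightarrow> j < d \<Longrightarrow> ent m aG d i j = append_id A i j"
    and dec: "dec_inv A b F ?n ?z"
    and k: "k = 1 + card (fractional_rows (c + d) ?n ?z)"
    using inv n unfolding loop_inv_def by auto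
  obtain ps where ps: "snd ` set ps \<subseteq> integer_points A b" "out = 1 # encode_pairs ps"
    "\<And>k. k < d \<Longrightarrow> a $ k = comb d ps $ k + ?z (c + k)"
    using inv unfolding loop_inv_def by auto
  have nFV: "\<bar>x\<bar> \<le> V" if "\<bar>x\<bar> \<le> l * F" "l \<le> F" for x l
    using that F mult_right_mono[of l F F] by linarith
  have zF: "\<bar>?z i\<bar> \<le> ?n * F" if "i < c + d" for i
    using dec that unfolding dec_inv_def dims_A by blast
  have zG: "?z i = (\<Sum>k<d. append_id A i k * ?z (c + k))" if "i < c + d" for i
    using dec that unfolding dec_inv_def dims_A by blast
  show ?thesis
  proof (rule wp_Seq, rule wp_round_point[OF m n, where G = "append_id A" and w = "\<lambda>k. ?z (c + k)"], goal_cases)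
    case (1 f)
    show ?case by (rule minor_append_id[OF TU A]) (use 1 in auto)
  next
    case (2 k l)
    then show ?case by (auto simp: append_id_def)
  next
    case (3 i k)
    then show ?case by (rule G)
  next
    case (4 i)
    then show ?case by (rule zG)
  next
    case (5 i)
    then show ?case using abs_div_bound[OF n zF[OF 5]] nFV nF by blast
  next
    case (6 i)
    have "\<bar>?n * (- ?z i div ?n)\<bar> \<le> ?n * F" using zF[OF 6] by (intro abs_div_bound[OF n]) simp
    then show ?case using nFV nF by simp
  next
    case (7 m1)
    note fr1 = frameD[OF 7(1)]
    have m1: "has_dims m1" using has_dims_frame[OF 7(1) _ m] by simp
    have e1: "var m1 vN = ?n" "arr m1 aZ = arr m aZ" "arr m1 aG = arr m aG" using fr1 by simp_all
    let ?y = "vals m1 aY"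
    show ?case
    proof (rule wp_Seq, rule wp_choose_coeff[OF m1], goal_cases)
      case 1
      show ?case using n e1 by simp
    next
      case (2 m2)
      note fr2 = frameD[OF 2(1)]
      have m2: "has_dims m2" using has_dims_frame[OF 2(1) _ m1] by simp
      have e2: "var m2 vN = ?n" "arr m2 aZ = arr m aZ" "arr m2 aG = arr m aG" "arr m2 aY = arr m1 aY"
        using fr2 e1 by simp_all
      define l where "l = var m2 vL"
      define x where "x = vec d (\<lambda>k. ?y (c + k) div ?n)"
      note step = dec_step[OF dec n, unfolded dims_A, OF 7(3) 2(3)[folded l_def] 2(4-6)[unfolded e1, folded l_def]]
      \<comment> \<open>Stated for any \<open>z'\<close> because it is used twice: beforehand to
        bound the values to be stored, and afterwards for the new memory.\<close>
      have step': "dec_inv A b F (?n - l) z'"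
        "l \<noteq> ?n \<Longrightarrow> card (fractional_rows (c + d) (?n - l) z') < card (fractional_rows (c + d) ?n ?z)"
        if "\<And>i. i < c + d \<Longrightarrow> z' i = ?z i - l * (?y i div ?n)" for z'
        using step(1,4)[of z'] that by blast+
      have l: "0 < l" "l \<le> ?n" using 2(3,4) e1 by (simp_all add: l_def)
      have yb: "?y i div ?n \<le> b $ i" if "i < c" for i
        by (rule step(2)[OF _ refl that])
      have yG: "?y i div ?n = (\<Sum>k<d. append_id A i k * (?y (c + k) div ?n))" if "i < c + d" for i
        by (rule step(3)[OF _ refl that])
      have x: "x \<in> integer_points A b"
      proof (subst integer_points_iff)
        show "\<forall>i<dim_row A. (\<Sum>k<dim_col A. A $$ (i, k) * x $ k) \<le> b $ i"
        proof (intro allI impI)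
          fix i assume i: "i < dim_row A"
          have "(\<Sum>k<dim_col A. A $$ (i, k) * x $ k) = (\<Sum>k<d. append_id A i k * (?y (c + k) div ?n))"
            using i by (intro sum.cong) (auto simp: x_def append_id_def)
          also have "\<dots> \<le> b $ i" using yG[of i] yb[of i] i by simp
          finally show "(\<Sum>k<dim_col A. A $$ (i, k) * x $ k) \<le> b $ i" .
        qed
      qed (use b in \<open>simp_all add: x_def\<close>)
      show ?case
      proof (rule wp_Seq, rule wp_write_pair[OF m2], goal_cases)
        case (1 m3)
        note fr3 = frameD[OF 1(1)]
        have m3: "has_dims m3" using has_dims_frame[OF 1(1) _ m2] by simp
        have e3: "var m3 vN = ?n" "arr m3 aZ = arr m aZ" "arr m3 aG = arr m aG" "arr m3 aY = arr m1 aY" "var m3 vL = l"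
          using fr3 e2 by (simp_all add: l_def)
        define z' where "z' i = ?z i - l * (?y i div ?n)" for i
        note dec' = step'[of z', OF z'_def]
        show ?case
        proof (rule wp_subtract_pair[OF m3], goal_cases)
          case (1 i)
          have "\<bar>z' i\<bar> \<le> (?n - l) * F" using dec'(1) 1 unfolding dec_inv_def dims_A by blast
          moreover have "?n - l \<le> F" using nF l by simp
          ultimately have "\<bar>z' i\<bar> \<le> V" by (rule nFV)
          then show ?case using e3 by (simp add: z'_def)
        next
          case 2
          show ?case using e3 l nF nFV[of "?n - l" 1] F(1) by simp
        next
          case (3 m4)
          note fr4 = frameD[OF 3(1)]
          have m4: "has_dims m4" using has_dims_frame[OF 3(1) _ m3] by simp
          have e4: "var m4 vN = ?n - l" "arr m4 aG = arr m aG" using 3(3) fr4 e3 by simp_all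
          have z4: "vals m4 aZ i = ?z i - l * (?y i div ?n)" if "i < c + d" for i
            using 3(4)[OF that] e3 by simp
          note dec4 = step'[of "vals m4 aZ", OF z4]
          let ?ps = "ps @ [(nat l, x)]"
          have psc: "snd ` set ps \<subseteq> carrier_vec d" "x \<in> carrier_vec d"
            using ps(1) by (auto simp: integer_points_def x_def)
          have coord: "a $ k = comb d ?ps $ k + vals m4 aZ (c + k)" if "k < d" for k
          proof -
            have "comb d ?ps $ k = comb d ps $ k + l * x $ k"
              using that psc l by (simp add: comb_index image_Un)
            then show ?thesis using ps(3)[OF that] z4[of "c + k"] that by (simp add: x_def)
          qed
          have out: "out @ var m2 vL # map (\<lambda>k. arr m2 aY (int c + int k) div var m2 vN) [0..<d] =
              1 # encode_pairs ?ps"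
            using ps(2) l(1) e2 by (simp add: encode_pairs_append encode_pairs_def l_def x_def)
          have "snd ` set ?ps \<subseteq> integer_points A b" using ps(1) x by simp
          with coord have ex: "\<exists>qs. snd ` set qs \<subseteq> integer_points A b \<and>
              1 # encode_pairs ?ps = 1 # encode_pairs qs \<and>
              (\<forall>k<d. a $ k = comb d qs $ k + vals m4 aZ (c + k))"
            by blast
          define k' where
            "k' = (if ?n - l = 0 then 0 else 1 + card (fractional_rows (c + d) (?n - l) (vals m4 aZ)))"
          \<comment> \<open>Either n is exhausted and the variant is 0, or a fractional row has
            disappeared.\<close>
          have k': "k' < k"
            unfolding k k'_def using dec4(2) by auto
          have "loop_inv k' (m4, inp, 1 # encode_pairs ?ps)"
            unfolding loop_inv_def prod.case e4 k'_def using m4 dec4(1) G ex nF l by simp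
          then show ?case
            unfolding out using k' by blast
        qed
      qed
    qed
  qed
qed

lemma wp_decompose:
  assumes inv: "loop_inv k (m, inp, out)" and k: "k \<le> N"
  shows "wp decompose (\<lambda>(m', inp', out'). solves_monoid_decomposition d (integer_points A b) a out') (m, inp, out)"
  unfolding decompose_def
proof (rule wp_While[where I = loop_inv])
  fix k s assume inv: "loop_inv k s" and pos: "0 < aval (Var vN) (fst s)"
  obtain m inp out where s: "s = (m, inp, out)" by (cases s)
  show "wp (round_point ;; choose_coeff ;; write_pair ;; subtract_pair) (\<lambda>s'. \<exists>k'<k. loop_inv k' s') s"
    using wp_decompose_body inv pos unfolding s by (simp add: wp_eval)
next
  fix k s assume inv: "loop_inv k s" and stop: "\<not> 0 < aval (Var vN) (fst s)"
  obtain m inp out where s: "s = (m, inp, out)" by (cases s)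
  have dec: "dec_inv A b F (var m vN) (vals m aZ)" using inv unfolding s loop_inv_def by simp
  moreover have "\<not> 0 < var m vN" using stop unfolding s by (simp add: wp_eval)
  ultimately have n: "var m vN = 0" unfolding dec_inv_def by simp
  \<comment> \<open>At n = 0 the bound \<open>n * F\<close> on the rows forces the rest to
    vanish.\<close>
  have z: "vals m aZ i = 0" if "i < c + d" for i
  proof -
    have "\<bar>vals m aZ i\<bar> \<le> var m vN * F" using dec that unfolding dec_inv_def dims_A by blast
    then show ?thesis using n by simp
  qed
  obtain ps where ps: "snd ` set ps \<subseteq> integer_points A b" "out = 1 # encode_pairs ps"
    "\<And>k. k < d \<Longrightarrow> a $ k = comb d ps $ k + vals m aZ (c + k)"
    using inv unfolding s loop_inv_def by auto
  have psc: "snd ` set ps \<subseteq> carrier_vec d" using ps(1) by (auto simp: integer_points_def)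
  have "a = comb d ps"
    using a comb_carrier[OF psc] ps(3) z[of "c + _"] by (intro eq_vecI) auto
  then show "case s of (m', inp', out') \<Rightarrow> solves_monoid_decomposition d (integer_points A b) a out'"
    using ps(1,2) unfolding s solves_monoid_decomposition_def mon_def by auto
qed (use inv k in auto)

lemma wp_monoid_program:
  assumes entries: "\<And>x. x \<in> set (entries A b a) \<Longrightarrow> \<bar>x\<bar> \<le> V"
    and sums: "\<And>i j. i < c \<Longrightarrow> j \<le> d \<Longrightarrow> \<bar>\<Sum>l<j. A $$ (i, l) * a $ l\<bar> \<le> F"
    and aF: "\<And>j. j < d \<Longrightarrow> \<bar>a $ j\<bar> \<le> F"
  shows "wp monoid_program (\<lambda>(m, inp, out). solves_monoid_decomposition d (integer_points A b) a out)
    (\<lambda>_. 0, input_tape A b a, [])"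
proof -
  let ?Gs = "concat (mat_to_list A)"
  have FV: "F \<le> V" using F mult_left_mono[of 1 F F] by linarith
  have Gs: "?Gs ! (i * d + j) = A $$ (i, j)" if "i < c" "j < d" for i j
    using that index_less[OF that] by (simp add: concat_mat_to_list)
  have Gsum: "(\<Sum>l<j. ?Gs ! (i * d + l) * list_of_vec a ! l) = (\<Sum>l<j. A $$ (i, l) * a $ l)"
    if "i < c" "j \<le> d" for i j
    using that Gs a by (intro sum.cong) (auto simp: list_of_vec_index)
  have tape: "input_tape A b a = int c # int d # ?Gs @ list_of_vec b @ list_of_vec a @ []"
    by (simp add: input_tape_def entries_def)
  show ?thesis
    unfolding monoid_program_def tape
  proof (rule wp_Seq, rule wp_read_input, goal_cases)
    case (7 i j)
    then show ?case using Gsum sums[of i j] FV by simp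
  next
    case (8 m1)
    let ?z = "vals m1 aZ"
    have z_top: "?z i = (\<Sum>l<d. A $$ (i, l) * a $ l)" if "i < c" for i
      using 8(7)[OF that] Gsum[OF that order_refl] by simp
    have z_bot: "?z (c + j) = a $ j" if "j < d" for j
      using 8(6)[OF that] that a by (simp add: list_of_vec_index)
    have zF: "\<bar>?z i\<bar> \<le> F" if "i < c + d" for i
      using that z_top[of i] z_bot[of "i - c"] sums[of i d] aF[of "i - c"] by (cases "i < c") auto
    have B: "vals m1 aB i = b $ i" if "i < c" for i
      using 8(5)[OF that] that b by (simp add: list_of_vec_index)
    have G: "ent m1 aG d i j = append_id A i j" if "i < c + d" "j < d" for i j
    proof (cases "i < c")
      case True
      then show ?thesis using 8(3) Gs that by (simp add: append_id_def)
    next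
      case False
      then show ?thesis using 8(4)[of "i - c" j] that by (auto simp: append_id_def)
    qed
    have zG: "?z i = (\<Sum>k<d. append_id A i k * ?z (c + k))" if "i < c + d" for i
    proof (cases "i < c")
      case True
      then show ?thesis
        unfolding z_top[OF True] using z_bot by (intro sum.cong) (auto simp: append_id_def)
    next
      case False
      then have "(\<Sum>k<d. append_id A i k * ?z (c + k)) = (\<Sum>k<d. if k = i - c then ?z i else 0)"
        by (intro sum.cong) (auto simp: append_id_def)
      also have "\<dots> = ?z i" using that False by auto
      finally show ?thesis by simp
    qed
    show ?case
    proof (rule wp_Seq, rule wp_least_scale[OF 8(2) _ F(1) FV], goal_cases)
      case (1 i)
      then show ?case using zF by simp
    next
      case (2 m2)
      note fr2 = frameD[OF 2(1)]
      have m2: "has_dims m2" using has_dims_frame[OF 2(1) _ 8(2)] by simp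
      let ?n = "var m2 vN"
      show ?case
      proof (rule wp_Seq, rule wp_check_scale[OF m2], goal_cases)
        case (1 m3)
        note fr3 = frameD[OF 1(1)]
        have m3: "has_dims m3" using has_dims_frame[OF 1(1) _ m2] by simp
        have e3: "var m3 vN = ?n" "arr m3 aZ = arr m1 aZ" "arr m3 aG = arr m1 aG"
          "arr m2 aZ = arr m1 aZ" "arr m2 aB = arr m1 aB"
          using fr2 fr3 by simp_all
        have ok: "0 < var m3 vOk \<longleftrightarrow> (\<forall>i<c. ?z i \<le> ?n * b $ i)"
          using 1(3) e3 B by simp
        show ?case
        proof (rule wp_Seq, rule wp_check_zero[OF m3], goal_cases)
          case (1 m4)
          note fr4 = frameD[OF 1(2)]
          have a0: "a $ j = 0" if "j < d" for j using 1(1) z_bot[OF that] e3 that by simp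
          have z0: "?z i = 0" if "i < c + d" for i
            unfolding zG[OF that] using z_bot a0 by simp
          \<comment> \<open>For a = 0 the empty list is the decomposition and the loop is not
            entered.\<close>
          have "loop_inv 0 (m4, [], [1])"
            unfolding loop_inv_def dec_inv_def
            using has_dims_frame[OF 1(2) _ m3] 1(4) F(1) G fr4 e3 z0 a0
            by (auto simp: encode_pairs_def comb_def simp flip: of_nat_add intro!: exI[of _ "[]"])
          then show ?case
            using 1(5) by (intro wp_IfPos wp_Seq wp_Write) (auto simp: wp_eval intro: wp_decompose)
        next
          case (2 m4)
          note fr4 = frameD[OF 2(2)]
          have m4: "has_dims m4" using has_dims_frame[OF 2(2) _ m3] by simp
          have e4: "var m4 vN = ?n" "arr m4 aZ = arr m1 aZ" "arr m4 aG = arr m1 aG" "var m4 vOk = var m3 vOk"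
            using fr4 e3 by simp_all
          have n: "1 \<le> ?n" "?n \<le> F" using \<open>1 \<le> ?n\<close> \<open>?n \<le> F\<close> by auto
          show ?case
          proof (rule wp_IfPos, goal_cases)
            case 1
            then have ok': "\<forall>i<c. ?z i \<le> ?n * b $ i" using ok e4 by (simp add: wp_eval)
            let ?k = "1 + card (fractional_rows (c + d) ?n ?z)"
            have "\<bar>?z i\<bar> \<le> ?n * F" if "i < c + d" for i
              using zF[OF that] mult_right_mono[of 1 ?n F] n(1) F(1) by linarith
            then have "loop_inv ?k (m4, [], [1])"
              unfolding loop_inv_def dec_inv_def
              using m4 n G e4 ok' zG z_bot a
              by (auto simp: encode_pairs_def comb_def intro!: exI[of _ "[]"])
            moreover have "card (fractional_rows (c + d) ?n ?z) \<le> card {..<c + d}"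
              by (intro card_mono) (auto simp: fractional_rows_def)
            then have "?k \<le> N" using dims by simp
            ultimately show ?case
              by (intro wp_Seq wp_Write) (simp, rule wp_decompose)
          next
            case 2
            then have not_ok: "\<not> (\<forall>i<c. ?z i \<le> ?n * b $ i)" using ok e4 by (simp add: wp_eval)
            have "a \<notin> mon d (integer_points A b)"
            proof
              assume mon: "a \<in> mon d (integer_points A b)"
              have "a \<noteq> 0\<^sub>v d" using \<open>\<not> (\<forall>j<d. _ j = 0)\<close> z_bot e3 by auto
              \<comment> \<open>A decomposition would have a positive scale, which cannot be below
                the least candidate n.\<close>
              then obtain n' where n': "0 < n'" "\<forall>i<c. (\<Sum>k<d. A $$ (i, k) * a $ k) \<le> n' * b $ i"
                using mon_scale[of a A b] mon b by auto
              then have zn': "\<forall>i<c. ?z i \<le> n' * vals m1 aB i" using z_top B by simp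
              then have "?n \<le> n'" using n'(1) \<open>\<And>n. 1 \<le> n \<Longrightarrow> _ n \<Longrightarrow> ?n \<le> n\<close> by simp
              have "?z i \<le> ?n * b $ i" if i: "i < c" for i
              proof (cases "0 < b $ i")
                case True
                then show ?thesis
                  using \<open>\<And>i. i < c \<Longrightarrow> 0 < vals m1 aB i \<Longrightarrow> _ i\<close>[OF i] B[OF i] by simp
              next
                case False
                \<comment> \<open>With a right-hand side that is not positive, the smaller scale is
                  the weaker demand.\<close>
                then have "n' * b $ i \<le> ?n * b $ i" using \<open>?n \<le> n'\<close> by (simp add: mult_right_mono_neg)
                then show ?thesis using zn' i B[OF i] by auto
              qed
              then show False using not_ok by blast
            qed
            then show ?case
              by (intro wp_Write) (simp add: solves_monoid_decomposition_def)
          qed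
        qed
      qed
    qed
  qed (use entries a b in \<open>auto simp: concat_mat_to_list entries_def\<close>)
qed

end

lemma bit_length_le_sum_list: "x \<in> set xs \<Longrightarrow> bit_length x \<le> sum_list (map bit_length xs)"
  by (metis elem_le_sum_list in_set_conv_nth length_map nth_map)

theorem corollary2p6:
  shows "\<exists>(prog :: com) (p :: nat poly).
    \<forall>(c :: nat) (d :: nat) (A :: int mat) (b :: int vec) (a :: int vec).
      c > 0 \<longrightarrow> d > 0 \<longrightarrow>
      A \<in> carrier_mat c d \<longrightarrow> totally_unimodular A \<longrightarrow>
      b \<in> carrier_vec c \<longrightarrow> a \<in> carrier_vec d \<longrightarrow>
      (\<exists>t out. computes prog (input_tape A b a) t out \<and>
               t \<le> poly p (encoding_length A b a) \<and>
               solves_monoid_decomposition d (integer_points A b) a out)"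
proof -
  obtain q :: "nat poly" where q: "\<And>N. com_factor N monoid_program = poly q N"
    using com_factor_poly by blast
  \<comment> \<open>The two linear factors stand for the iteration bound L + 1, substituted into q,
    and the cell length 6 L + 3.\<close>
  define p where "p = pcompose q [:1, 1:] * [:3, 6:]"
  have "\<exists>t out. computes monoid_program (input_tape A b a) t out \<and> t \<le> poly p (encoding_length A b a) \<and>
      solves_monoid_decomposition d (integer_points A b) a out"
    if A: "A \<in> carrier_mat c d" and TU: "totally_unimodular A" and b: "b \<in> carrier_vec c" and a: "a \<in> carrier_vec d"
    for c d A b a
  proof -
    define L where "L = encoding_length A b a"
    have small: "\<bar>x\<bar> < 2 ^ L" if "x \<in> set (entries A b a)" for x
    proof -
      have "bit_length x - 1 \<le> L"
        using bit_length_le_sum_list[OF that] by (simp add: L_def encoding_length_def)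
      then have "(2 :: int) ^ (bit_length x - 1) \<le> 2 ^ L" by simp
      then show ?thesis using abs_less_bit_length[of x] by linarith
    qed
    have "length xs \<le> sum_list (map bit_length xs)" for xs
    proof (induction xs)
      case (Cons x xs)
      then show ?case using bit_length_pos[of x] by simp
    qed simp
    \<comment> \<open>Every entry has length at least 1, so the encoding length also controls the
      dimensions, which it does not count.\<close>
    from this[of "entries A b a"] have len: "c * d + c + d \<le> L"
      using A a b by (simp add: L_def encoding_length_def entries_def concat_mat_to_list)
    have "d < 2 ^ L" using len less_exp[of L] by linarith
    then have dL: "int d \<le> 2 ^ L" by (metis of_nat_le_iff of_nat_numeral of_nat_power less_imp_le)
    \<comment> \<open>F = 2^(3 L) bounds sums of at most 2^L products of two numbers below 2^L. F *
      F is 2^(6 L); the extra factor 2 in V makes L + 1 <= 2^(L + 1) <= V available. Such cells have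
      at most 6 L + 2 binary digits and a sign.\<close>
    interpret decomposition_bounds "L + 1" "6 * L + 3" "2 ^ (6 * L + 1)" c d A b a "2 ^ (3 * L)"
    proof
      fix v :: int assume "\<bar>v\<bar> \<le> 2 ^ (6 * L + 1)"
      also have "(2 :: int) ^ (6 * L + 1) < 2 ^ (6 * L + 2)" by simp
      finally show "bit_length v \<le> 6 * L + 3" by (rule bit_length_leI) simp
    next
      have "int (L + 1) \<le> 2 ^ (L + 1)" using less_exp[of "L + 1"]
        by (metis of_nat_le_iff of_nat_numeral of_nat_power less_imp_le)
      also have "\<dots> \<le> (2 :: int) ^ (6 * L + 1)" by (intro power_increasing) auto
      finally show "int (L + 1) \<le> 2 ^ (6 * L + 1)" .
    next
      have "(2 :: int) ^ (3 * L) * 2 ^ (3 * L) = 2 ^ (6 * L)" by (simp flip: power_add)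
      then show "(2 :: int) ^ (3 * L) * 2 ^ (3 * L) \<le> 2 ^ (6 * L + 1)" by simp
    qed (use A TU b a len in auto)
    have in_a: "a $ l \<in> set (entries A b a)" if "l < d" for l
      using that a by (auto simp: entries_def set_list_of_vec vec_set_def)
    have in_A: "A $$ (i, l) \<in> set (entries A b a)" if "i < c" "l < d" for i l
    proof -
      have "map (\<lambda>j. A $$ (i, j)) [0..<d] \<in> set (mat_to_list A)"
        unfolding mat_to_list_def set_map
        by (rule image_eqI[where x = i]) (use that A in simp_all)
      moreover have "A $$ (i, l) \<in> set (map (\<lambda>j. A $$ (i, j)) [0..<d])"
        unfolding set_map by (rule image_eqI[where x = l]) (use that in simp_all)
      ultimately show ?thesis unfolding entries_def set_append set_concat by blast
    qed
    have LF: "(2 :: int) ^ L \<le> 2 ^ (3 * L)" "(2 :: int) ^ L \<le> 2 ^ (6 * L + 1)"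
      by (intro power_increasing; simp)+
    have "wp monoid_program (\<lambda>(m, inp, out). solves_monoid_decomposition d (integer_points A b) a out)
      (\<lambda>_. 0, input_tape A b a, [])"
    proof (rule wp_monoid_program)
      fix x assume "x \<in> set (entries A b a)"
      then show "\<bar>x\<bar> \<le> 2 ^ (6 * L + 1)" using small[of x] LF by linarith
    next
      fix j assume "j < d"
      then show "\<bar>a $ j\<bar> \<le> 2 ^ (3 * L)" using small[OF in_a] LF by (smt (verit))
    next
      fix i j assume i: "i < c" and j: "j \<le> d"
      have "\<bar>\<Sum>l<j. A $$ (i, l) * a $ l\<bar> \<le> (\<Sum>l<j. \<bar>A $$ (i, l)\<bar> * \<bar>a $ l\<bar>)"
        by (rule order_trans[OF sum_abs]) (simp add: abs_mult)
      also have "\<dots> \<le> (\<Sum>l<j. 2 ^ L * 2 ^ L)"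
        using i j small[OF in_A] small[OF in_a] by (intro sum_mono mult_mono) (auto intro: less_imp_le)
      also have "\<dots> = int j * (2 ^ L * 2 ^ L)" by simp
      also have "\<dots> \<le> 2 ^ L * (2 ^ L * 2 ^ L)"
        using j dL by (intro mult_right_mono) auto
      also have "\<dots> = 2 ^ (3 * L)" by (simp flip: power_add)
      finally show "\<bar>\<Sum>l<j. A $$ (i, l) * a $ l\<bar> \<le> 2 ^ (3 * L)" .
    qed
    moreover have "bounded (\<lambda>_. 0)" unfolding bounded_def by simp
    ultimately obtain t m inp out where "exec monoid_program (\<lambda>_. 0, input_tape A b a, []) t (m, inp, out)"
      "t \<le> com_factor (L + 1) monoid_program * (6 * L + 3)"
      "solves_monoid_decomposition d (integer_points A b) a out"
      unfolding wp_def by auto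
    moreover have "com_factor (L + 1) monoid_program * (6 * L + 3) = poly p L"
      by (simp add: q p_def poly_pcompose algebra_simps)
    ultimately show ?thesis unfolding computes_def L_def by metis
  qed
  then show ?thesis by blast
qed

end
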